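(* Consider any Kac-Moody root datum, with Weyl group $W$ and associated affine Weyl semigroup $W_{\mathcal T}=W\ltimes\mathcal T$, and let $x=w_x\varepsilon^{\mu_x},\ y=w_y\varepsilon^{\mu_y}\in W_{\mathcal T}$. Assume that the generalised Demazure product $x*y$ is well-defined. Then: (i) $\ell(x*y)=\ell(x)+\ell(y)$ if and only if $\ell(xy)=\ell(x)+\ell(y)$, in which case $x*y=xy$. (ii) For every $(u,v)\in M_{x,y}$, $\ell(x*y)=\ell(x)+\ell(y)-d(u\Rightarrow w_yv)$.
   Context: Fix a Kac-Moody root datum with weight lattice $P$, coweight lattice $P^\vee$, pairing $\langle\cdot,\cdot\rangle$, simple roots $\alpha_i$, simple coroots $\alpha_i^\vee$, Weyl group $W$ generated by simple reflections $s_i$ with word length $\ell$, set of (real) roots $\Phi$, positive roots $\Phi^+$, and for $\beta\in\Phi^+$ coroot $\beta^\vee$ and reflection $s_\beta$. Let $\rho$ be the sum of the fundamental weights, so $\langle\rho,\alpha_i^\vee\rangle=1$ for all $i$. The Tits cone is $\mathcal T=\bigcup_{w\in W}w(P^\vee_{\mathrm{dom}})$, where $P^\vee_{\mathrm{dom}}$ is the set of dominant coweights. $W_{\mathcal T}=W\ltimes\mathcal T$ has elements $w\varepsilon^\mu$ ($w\in W$, $\mu\in\mathcal T$) with product $(w\varepsilon^\mu)(w'\varepsilon^{\mu'})=ww'\varepsilon^{w'^{-1}\mu+\mu'}$. Length function on $W_{\mathcal T}$ (Muthiah-Orr): for $w\in W$ let $\mathrm{Inv}(w)=\{\beta\in\Phi^+:w\beta<0\}$;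 for $\mu\in\mathcal T$ let $\mu_+$ be its dominant $W$-conjugate; then $\ell(w\varepsilon^\mu)=\langle 2\rho,\mu_+\rangle+|\{\beta\in\mathrm{Inv}(w):\langle\beta,\mu\rangle\ge0\}|-|\{\beta\in\mathrm{Inv}(w):\langle\beta,\mu\rangle<0\}|$. Quantum Bruhat graph: $\mathrm{QBG}(W)$ is the directed weighted graph with vertex set $W$ and an edge $w\to ws_\beta$ ($\beta\in\Phi^+$) if either $\ell(ws_\beta)=\ell(w)+1$ (Bruhat edge, weight $0$) or $\ell(ws_\beta)=\ell(w)+1-\langle2\rho,\beta^\vee\rangle$ (quantum edge, weight $\beta^\vee$). The length of a path is its number of edges, its weight $\mathrm{wt}(p)$ is the sum of its edge weights, and $d(u\Rightarrow v)$ is the length of a shortest path from $u$ to $v$. Length positivity: let $\Phi^+(\beta)=1$ if $\beta\in\Phi^+$ and $0$ otherwise. For $x=w\varepsilon^\mu$, $\beta\in\Phi$, put $\ell(x,\beta)=\langle\beta,\mu\rangle+\Phi^+(\beta)-\Phi^+(w\beta)$, and $\mathrm{LP}(x)=\{v\in W:\ell(x,v\beta)\ge0\ \text{for all }\beta\in\Phi^+\}$. Generalised Demazure product: $M_{x,y}$ is the (non-empty) set of pairs $(u,v)\in\mathrm{LP}(x)\times\mathrm{LP}(y)$ with $d(u\Rightarrow w_yv)\le d(u'\Rightarrow w_yv')$ for all $(u',v')\in\mathrm{LP}(x)\times\mathrm{LP}(y)$. For $(u,v)\in M_{x,y}$ and a shortest path $p$ from $u$ to $w_yv$ in $\mathrm{QBG}(W)$,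 $x*_{u,v}^py=w_xuv^{-1}\varepsilon^{vu^{-1}\mu_x+\mu_y-v\,\mathrm{wt}(p)}$. "Well-defined" means that this element is in $W_{\mathcal T}$ and is the same for all $(u,v)\in M_{x,y}$ and all such $p$, in which case it is denoted $x*y$; this assumption is understood to include that the weight function of $\mathrm{QBG}(W)$ is well-defined, i.e. any two shortest paths in $\mathrm{QBG}(W)$ with the same endpoints have the same weight. *)

theory Defs
  imports Complex_Main "Graph_Theory.Arc_Walk"
begin

section \<open>Integer multiples in an abelian group\<close>

definition zsmul :: "int \<Rightarrow> 'a::ab_group_add \<Rightarrow> 'a" where
  "zsmul k a = (if 0 \<le> k then (((+) a) ^^ nat k) 0 else - ((((+) a) ^^ nat (- k)) 0))"

lemma zsmul_0: "zsmul 0 a = 0"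
  by (simp add: zsmul_def)

lemma zsmul_plus1: "zsmul (k + 1) a = a + zsmul k a"
proof (cases "0 \<le> k")
  case True
  then have "nat (k + 1) = Suc (nat k)" by simp
  with True show ?thesis by (simp add: zsmul_def)
next
  case False
  then have "nat (- k) = Suc (nat (- (k + 1)))" by simp
  then have "(((+) a) ^^ nat (- k)) 0 = a + (((+) a) ^^ nat (- (k + 1))) 0"
    by (simp only: funpow.simps o_apply)
  moreover have "k + 1 = 0" if "0 \<le> k + 1" using that False by simp
  ultimately show ?thesis using False by (cases "k + 1 = 0") (auto simp: zsmul_def)
qed

lemma zsmul_minus1: "zsmul (k - 1) a = zsmul k a - a"
  using zsmul_plus1[of "k - 1" a] by simp

lemma zsmul_add_left: "zsmul (k + l) a = zsmul k a + zsmul l a"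
proof (induction k rule: int_induct[where k = 0])
  case base show ?case by (simp add: zsmul_0)
next
  case (step1 i)
  then show ?case
    using zsmul_plus1[of "i + l" a] zsmul_plus1[of i a] by (simp add: algebra_simps)
next
  case (step2 i)
  show ?case
  proof -
    have "i - 1 + l = i + l - 1" by simp
    then have "zsmul (i - 1 + l) a = zsmul (i + l) a - a" by (simp only: zsmul_minus1)
    with step2 show ?thesis by (simp add: zsmul_minus1 algebra_simps)
  qed
qed

lemma zsmul_add_right: "zsmul k (a + b) = zsmul k a + zsmul k b"
  by (induction k rule: int_induct[where k = 0])
    (simp_all add: zsmul_0 zsmul_plus1 zsmul_minus1 algebra_simps)

lemma zsmul_mult: "zsmul k (zsmul l a) = zsmul (k * l) a"
proof (induction k rule: int_induct[where k = 0])
  case base show ?case by (simp add: zsmul_0)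
next
  case (step1 i)
  have "(i + 1) * l = l + i * l" by (simp add: algebra_simps)
  then have "zsmul ((i + 1) * l) a = zsmul l a + zsmul (i * l) a"
    by (simp only: zsmul_add_left)
  with step1 show ?case by (simp only: zsmul_plus1)
next
  case (step2 i)
  then show ?case
    using zsmul_add_left[of "(i - 1) * l" l a] by (simp add: zsmul_minus1 algebra_simps)
qed

interpretation zmod: module "zsmul :: int \<Rightarrow> 'a::ab_group_add \<Rightarrow> 'a"
  by unfold_locales
    (use zsmul_plus1[of 0] in \<open>simp_all add: zsmul_0 zsmul_add_left zsmul_add_right zsmul_mult\<close>)


section \<open>Kac-Moody root data\<close>

text \<open>
  The weight lattice $P$ and the coweight lattice $P^\vee$ are the (full) types \<open>'p\<close> and \<open>'q\<close>.
  The entry \<open>cartan D i j\<close> is $a_{ij} = \langle \alpha_j, \alpha_i^\vee \rangle$.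
\<close>

record ('i, 'p, 'q) root_datum =
  index :: "'i set"
  cartan :: "'i \<Rightarrow> 'i \<Rightarrow> int"
  pairing :: "'p \<Rightarrow> 'q \<Rightarrow> int"
  simple_root :: "'i \<Rightarrow> 'p"
  simple_coroot :: "'i \<Rightarrow> 'q"

definition generalized_cartan_matrix :: "'i set \<Rightarrow> ('i \<Rightarrow> 'i \<Rightarrow> int) \<Rightarrow> bool" where
  "generalized_cartan_matrix I A \<longleftrightarrow>
     finite I \<and>
     (\<forall>i\<in>I. A i i = 2) \<and>
     (\<forall>i\<in>I. \<forall>j\<in>I. i \<noteq> j \<longrightarrow> A i j \<le> 0) \<and>
     (\<forall>i\<in>I. \<forall>j\<in>I. A i j = 0 \<longleftrightarrow> A j i = 0)"

locale kac_moody_root_datum =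
  fixes D :: "('i, 'p::ab_group_add, 'q::ab_group_add) root_datum"
  assumes cartan: "generalized_cartan_matrix (index D) (cartan D)"
    and weights_free: "\<exists>B :: 'p set. finite B \<and> zmod.independent B \<and> zmod.span B = UNIV"
    and coweights_free: "\<exists>B :: 'q set. finite B \<and> zmod.independent B \<and> zmod.span B = UNIV"
    and pairing_additive_left: "\<And>\<mu>. additive (\<lambda>\<theta>. pairing D \<theta> \<mu>)"
    and pairing_additive_right: "\<And>\<theta>. additive (pairing D \<theta>)"
    and pairing_perfect_left:
      "\<And>f :: 'p \<Rightarrow> int. additive f \<Longrightarrow> \<exists>!\<mu>. \<forall>\<theta>. f \<theta> = pairing D \<theta> \<mu>"
    and pairing_perfect_right:
      "\<And>f :: 'q \<Rightarrow> int. additive f \<Longrightarrow> \<exists>!\<theta>. \<forall>\<mu>. f \<mu> = pairing D \<theta> \<mu>"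
    and simple_roots_independent:
      "inj_on (simple_root D) (index D)" "zmod.independent (simple_root D ` index D)"
    and simple_coroots_independent:
      "inj_on (simple_coroot D) (index D)" "zmod.independent (simple_coroot D ` index D)"
    and pairing_simple:
      "\<And>i j. i \<in> index D \<Longrightarrow> j \<in> index D \<Longrightarrow>
        pairing D (simple_root D j) (simple_coroot D i) = cartan D i j"


section \<open>Weyl group, roots, Tits cone\<close>

text \<open>
  The Weyl group is realised by its faithful action on the coweight lattice, so that its
  product is composition of functions and inverses are inverse functions. As the simple
  reflections are involutions, the words in them form a group.
\<close>

definition simple_reflection ::
    "('i, 'p, 'q::ab_group_add) root_datum \<Rightarrow> 'i \<Rightarrow> 'q \<Rightarrow> 'q" where
  "simple_reflection D i \<mu> = \<mu> - zsmul (pairing D (simple_root D i) \<mu>) (simple_coroot D i)"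

definition word_prod :: "('i, 'p, 'q::ab_group_add) root_datum \<Rightarrow> 'i list \<Rightarrow> 'q \<Rightarrow> 'q" where
  "word_prod D is = foldr (\<circ>) (map (simple_reflection D) is) id"

definition weyl_group :: "('i, 'p, 'q::ab_group_add) root_datum \<Rightarrow> ('q \<Rightarrow> 'q) set" where
  "weyl_group D = word_prod D ` lists (index D)"

definition word_length :: "('i, 'p, 'q::ab_group_add) root_datum \<Rightarrow> ('q \<Rightarrow> 'q) \<Rightarrow> nat" where
  "word_length D w = (LEAST n. \<exists>is \<in> lists (index D). word_prod D is = w \<and> length is = n)"

text \<open>The contragredient action, characterised by
  $\langle w\lambda, w\mu \rangle = \langle \lambda, \mu \rangle$.\<close>

definition weight_act ::
    "('i, 'p, 'q::ab_group_add) root_datum \<Rightarrow> ('q \<Rightarrow> 'q) \<Rightarrow> 'p \<Rightarrow> 'p" where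
  "weight_act D w \<beta> = (THE \<gamma>. \<forall>\<mu>. pairing D \<gamma> (w \<mu>) = pairing D \<beta> \<mu>)"

definition roots :: "('i, 'p, 'q::ab_group_add) root_datum \<Rightarrow> 'p set" where
  "roots D = {weight_act D w (simple_root D i) | w i. w \<in> weyl_group D \<and> i \<in> index D}"

definition pos_roots ::
    "('i, 'p::ab_group_add, 'q::ab_group_add) root_datum \<Rightarrow> 'p set" where
  "pos_roots D = {\<beta> \<in> roots D.
     \<exists>n :: 'i \<Rightarrow> nat. \<beta> = (\<Sum>i\<in>index D. zsmul (int (n i)) (simple_root D i))}"

definition coroot :: "('i, 'p, 'q::ab_group_add) root_datum \<Rightarrow> 'p \<Rightarrow> 'q" where
  "coroot D \<beta> = (THE \<gamma>. \<exists>w\<in>weyl_group D. \<exists>i\<in>index D.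
     \<beta> = weight_act D w (simple_root D i) \<and> \<gamma> = w (simple_coroot D i))"

definition reflection :: "('i, 'p, 'q::ab_group_add) root_datum \<Rightarrow> 'p \<Rightarrow> 'q \<Rightarrow> 'q" where
  "reflection D \<beta> \<mu> = \<mu> - zsmul (pairing D \<beta> \<mu>) (coroot D \<beta>)"

definition dominant :: "('i, 'p, 'q) root_datum \<Rightarrow> 'q set" where
  "dominant D = {\<mu>. \<forall>i\<in>index D. pairing D (simple_root D i) \<mu> \<ge> 0}"

definition tits_cone :: "('i, 'p, 'q::ab_group_add) root_datum \<Rightarrow> 'q set" where
  "tits_cone D = (\<Union>w\<in>weyl_group D. w ` dominant D)"

definition dominant_conjugate :: "('i, 'p, 'q::ab_group_add) root_datum \<Rightarrow> 'q \<Rightarrow> 'q" where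
  "dominant_conjugate D \<mu> = (THE \<nu>. \<nu> \<in> dominant D \<and> (\<exists>w\<in>weyl_group D. \<nu> = w \<mu>))"

text \<open>
  Fundamental weights need not exist in the weight lattice itself, so they are taken in
  $P \otimes \mathbb{R}$, that is, as additive real-valued functions on the coweight lattice.
  They are unique only up to weights that vanish on all coroots. The third argument of
  \<open>is_rho\<close> is the function $\langle \rho, \cdot \rangle$.
\<close>

definition fundamental_weights ::
    "('i, 'p, 'q::ab_group_add) root_datum \<Rightarrow> ('i \<Rightarrow> 'q \<Rightarrow> real) \<Rightarrow> bool" where
  "fundamental_weights D \<omega> \<longleftrightarrow>
     (\<forall>i\<in>index D. additive (\<omega> i)) \<and>
     (\<forall>i\<in>index D. \<forall>j\<in>index D. \<omega> i (simple_coroot D j) = (if i = j then 1 else 0))"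

definition is_rho :: "('i, 'p, 'q::ab_group_add) root_datum \<Rightarrow> ('q \<Rightarrow> real) \<Rightarrow> bool" where
  "is_rho D \<rho> \<longleftrightarrow> (\<exists>\<omega>. fundamental_weights D \<omega> \<and> \<rho> = (\<lambda>\<mu>. \<Sum>i\<in>index D. \<omega> i \<mu>))"


section \<open>The affine Weyl semigroup\<close>

text \<open>The element $w \varepsilon^\mu$ is the pair \<open>(w, \<mu>)\<close>.\<close>

type_synonym 'q affine = "('q \<Rightarrow> 'q) \<times> 'q"

definition affine_weyl_semigroup ::
    "('i, 'p, 'q::ab_group_add) root_datum \<Rightarrow> 'q affine set" where
  "affine_weyl_semigroup D = weyl_group D \<times> tits_cone D"

definition affine_mult :: "'q::ab_group_add affine \<Rightarrow> 'q affine \<Rightarrow> 'q affine" where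
  "affine_mult x y = (fst x \<circ> fst y, inv (fst y) (snd x) + snd y)"

definition inversions ::
    "('i, 'p::ab_group_add, 'q::ab_group_add) root_datum \<Rightarrow> ('q \<Rightarrow> 'q) \<Rightarrow> 'p set" where
  "inversions D w = {\<beta> \<in> pos_roots D. - weight_act D w \<beta> \<in> pos_roots D}"

definition affine_length ::
    "('i, 'p::ab_group_add, 'q::ab_group_add) root_datum \<Rightarrow> ('q \<Rightarrow> real) \<Rightarrow> 'q affine \<Rightarrow> real"
  where
  "affine_length D \<rho> x =
     2 * \<rho> (dominant_conjugate D (snd x))
     + real (card {\<beta> \<in> inversions D (fst x). pairing D \<beta> (snd x) \<ge> 0})
     - real (card {\<beta> \<in> inversions D (fst x). pairing D \<beta> (snd x) < 0})"


section \<open>The quantum Bruhat graph\<close>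

text \<open>An arc is a triple of its tail, its weight and its head.\<close>

type_synonym 'q qbg_arc = "('q \<Rightarrow> 'q) \<times> 'q \<times> ('q \<Rightarrow> 'q)"

definition bruhat_arcs ::
    "('i, 'p::ab_group_add, 'q::ab_group_add) root_datum \<Rightarrow> 'q qbg_arc set" where
  "bruhat_arcs D = {(w, 0, w \<circ> reflection D \<beta>) | w \<beta>.
     w \<in> weyl_group D \<and> \<beta> \<in> pos_roots D \<and>
     word_length D (w \<circ> reflection D \<beta>) = word_length D w + 1}"

definition quantum_arcs ::
    "('i, 'p::ab_group_add, 'q::ab_group_add) root_datum \<Rightarrow> ('q \<Rightarrow> real) \<Rightarrow> 'q qbg_arc set"
  where
  "quantum_arcs D \<rho> = {(w, coroot D \<beta>, w \<circ> reflection D \<beta>) | w \<beta>.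
     w \<in> weyl_group D \<and> \<beta> \<in> pos_roots D \<and>
     real (word_length D (w \<circ> reflection D \<beta>))
       = real (word_length D w) + 1 - 2 * \<rho> (coroot D \<beta>)}"

definition qbg ::
    "('i, 'p::ab_group_add, 'q::ab_group_add) root_datum \<Rightarrow> ('q \<Rightarrow> real)
      \<Rightarrow> ('q \<Rightarrow> 'q, 'q qbg_arc) pre_digraph" where
  "qbg D \<rho> = \<lparr>verts = weyl_group D, arcs = bruhat_arcs D \<union> quantum_arcs D \<rho>,
     tail = fst, head = (\<lambda>e. snd (snd e))\<rparr>"

definition path_weight :: "'q::ab_group_add qbg_arc list \<Rightarrow> 'q" where
  "path_weight p = sum_list (map (\<lambda>e. fst (snd e)) p)"

definition qbg_dist ::
    "('i, 'p::ab_group_add, 'q::ab_group_add) root_datum \<Rightarrow> ('q \<Rightarrow> real)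
      \<Rightarrow> ('q \<Rightarrow> 'q) \<Rightarrow> ('q \<Rightarrow> 'q) \<Rightarrow> nat" where
  "qbg_dist D \<rho> u v = (LEAST n. \<exists>p. pre_digraph.awalk (qbg D \<rho>) u p v \<and> length p = n)"

definition shortest_path ::
    "('i, 'p::ab_group_add, 'q::ab_group_add) root_datum \<Rightarrow> ('q \<Rightarrow> real)
      \<Rightarrow> ('q \<Rightarrow> 'q) \<Rightarrow> 'q qbg_arc list \<Rightarrow> ('q \<Rightarrow> 'q) \<Rightarrow> bool" where
  "shortest_path D \<rho> u p v \<longleftrightarrow>
     pre_digraph.awalk (qbg D \<rho>) u p v \<and> length p = qbg_dist D \<rho> u v"

definition qbg_weight_well_defined ::
    "('i, 'p::ab_group_add, 'q::ab_group_add) root_datum \<Rightarrow> ('q \<Rightarrow> real) \<Rightarrow> bool" where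
  "qbg_weight_well_defined D \<rho> \<longleftrightarrow>
     (\<forall>u v p p'. shortest_path D \<rho> u p v \<longrightarrow> shortest_path D \<rho> u p' v
        \<longrightarrow> path_weight p = path_weight p')"


section \<open>Length positivity and the generalised Demazure product\<close>

definition root_length ::
    "('i, 'p::ab_group_add, 'q::ab_group_add) root_datum \<Rightarrow> 'q affine \<Rightarrow> 'p \<Rightarrow> int" where
  "root_length D x \<beta> = pairing D \<beta> (snd x) + of_bool (\<beta> \<in> pos_roots D)
     - of_bool (weight_act D (fst x) \<beta> \<in> pos_roots D)"

definition length_positive ::
    "('i, 'p::ab_group_add, 'q::ab_group_add) root_datum \<Rightarrow> 'q affine \<Rightarrow> ('q \<Rightarrow> 'q) set" where
  "length_positive D x =
     {v \<in> weyl_group D. \<forall>\<beta>\<in>pos_roots D. root_length D x (weight_act D v \<beta>) \<ge> 0}"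

definition demazure_pairs ::
    "('i, 'p::ab_group_add, 'q::ab_group_add) root_datum \<Rightarrow> ('q \<Rightarrow> real)
      \<Rightarrow> 'q affine \<Rightarrow> 'q affine \<Rightarrow> (('q \<Rightarrow> 'q) \<times> ('q \<Rightarrow> 'q)) set" where
  "demazure_pairs D \<rho> x y =
     {(u, v). u \<in> length_positive D x \<and> v \<in> length_positive D y \<and>
        (\<forall>u'\<in>length_positive D x. \<forall>v'\<in>length_positive D y.
           qbg_dist D \<rho> u (fst y \<circ> v) \<le> qbg_dist D \<rho> u' (fst y \<circ> v'))}"

definition demazure_via ::
    "'q::ab_group_add affine \<Rightarrow> 'q affine \<Rightarrow> ('q \<Rightarrow> 'q) \<Rightarrow> ('q \<Rightarrow> 'q) \<Rightarrow> 'q qbg_arc list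
      \<Rightarrow> 'q affine" where
  "demazure_via x y u v p =
     (fst x \<circ> u \<circ> inv v, v (inv u (snd x)) + snd y - v (path_weight p))"

definition demazure_well_defined ::
    "('i, 'p::ab_group_add, 'q::ab_group_add) root_datum \<Rightarrow> ('q \<Rightarrow> real)
      \<Rightarrow> 'q affine \<Rightarrow> 'q affine \<Rightarrow> bool" where
  "demazure_well_defined D \<rho> x y \<longleftrightarrow>
     qbg_weight_well_defined D \<rho> \<and>
     (\<exists>z\<in>affine_weyl_semigroup D. \<forall>(u, v)\<in>demazure_pairs D \<rho> x y. \<forall>p.
        shortest_path D \<rho> u p (fst y \<circ> v) \<longrightarrow> demazure_via x y u v p = z)"

definition demazure_product ::
    "('i, 'p::ab_group_add, 'q::ab_group_add) root_datum \<Rightarrow> ('q \<Rightarrow> real)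
      \<Rightarrow> 'q affine \<Rightarrow> 'q affine \<Rightarrow> 'q affine" where
  "demazure_product D \<rho> x y =
     (THE z. \<exists>(u, v)\<in>demazure_pairs D \<rho> x y. \<exists>p.
        shortest_path D \<rho> u p (fst y \<circ> v) \<and> z = demazure_via x y u v p)"

end

theory Submission
  imports Defs
begin

text \<open>
  For $x = w\varepsilon^\mu$ and $v \in W$ one has
  $\ell(x) \ge \langle 2\rho, v^{-1}\mu\rangle - \ell(v) + \ell(wv)$, with equality iff
  $v \in \mathrm{LP}(x)$: the difference of the two sides is a sum of nonnegative contributions of
  the positive roots. If $v \in \mathrm{LP}(x * y)$ for some $(u, v) \in M_{x,y}$, then adding up
  these equalities for $x$, $y$ and $x * y$ and telescoping the length changes along a shortest
  path from $u$ to $w_y v$ gives (ii). Applying them to $xy$ instead shows that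
  $\ell(xy) = \ell(x) + \ell(y)$ iff some $(u, v) \in M_{x,y}$ has $u = w_y v$, which is (i).

  Length positivity of $v$ for $x * y$ rests on a study of $\mathrm{QBG}(W)$ under right
  multiplication by a simple reflection $s_\alpha$. Either the value of the root functional of
  $x * y$ at $v\alpha$ is at least $1$, or it is $0$ and $(us_\alpha, vs_\alpha)$ lies in $M_{x,y}$
  as well and yields the same element. Induction on the height of $\beta$ then gives nonnegativity
  at $v\beta$ for all $(u, v)$ and all positive roots $\beta$.

  That roots and coroots are simultaneously positive or negative is proved as for Coxeter groups, by
  reduction to rank two, which avoids an invariant bilinear form.
\<close>

section \<open>Linear algebra of a root datum\<close>

text \<open>At \<open>v\<beta>\<close> the root functional of \<open>x * y\<close> is the sum of
  that of \<open>x\<close> at \<open>u\<beta>\<close>, that of \<open>y\<close> at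
  \<open>v\<beta>\<close>, and a term depending only on the path from \<open>u\<close> to
  \<open>w_y v\<close>. The first two are nonnegative. For a simple root \<alpha> the third, called
  the gain, is additive along the path, and on a shortest path it can be as low as -1; the obstacle
  is that the first two must then make up for it. Minimality of the distance forces this: if
  \<open>x\<close> has value 0 at \<open>u\<alpha>\<close>, then \<open>u s_\<alpha>\<close> is
  length positive for \<open>x\<close> too, so no path from \<open>u s_\<alpha>\<close> to
  \<open>w_y v\<close> may save an edge, and similarly for \<open>y\<close>. A negative gain yields
  saving paths of both kinds, so both values are at least 1. Gains of single edges are bounded below
  by comparing lengths. A quantum edge labelled \<gamma> forces \<open>2 * \<rho>\<close> of the
  coroot to equal the length of the reflection plus 1, and then every inversion of the reflection
  other than \<gamma> pairs to 1 with the coroot.\<close>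

lemma additive_zsmul:
  fixes f :: "'a::ab_group_add \<Rightarrow> 'b::ring_1"
  assumes "additive f"
  shows "f (zsmul k a) = of_int k * f a"
proof (induction k rule: int_induct[where k = 0])
  case base show ?case by (simp add: zsmul_0 additive.zero[OF assms])
next
  case (step1 i)
  then show ?case by (simp add: zsmul_plus1 additive.add[OF assms] algebra_simps)
next
  case (step2 i)
  then show ?case by (simp add: zsmul_minus1 additive.diff[OF assms] algebra_simps)
qed

lemma zsmul_additive:
  fixes f :: "'a::ab_group_add \<Rightarrow> 'b::ab_group_add"
  assumes "additive f"
  shows "f (zsmul k a) = zsmul k (f a)"
proof (induction k rule: int_induct[where k = 0])
  case base show ?case by (simp add: zsmul_0 additive.zero[OF assms])
next
  case (step1 i)
  then show ?case by (simp add: zsmul_plus1 additive.add[OF assms])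
next
  case (step2 i)
  then show ?case by (simp add: zsmul_minus1 additive.diff[OF assms])
qed

lemma zsmul_minus_left: "zsmul (- k) a = - zsmul k a"
  using zsmul_add_left[of "- k" k a] by (simp add: zsmul_0 eq_neg_iff_add_eq_0)

lemma zsmul_diff_left: "zsmul (k - l) a = zsmul k a - zsmul l a"
  using zsmul_add_left[of k "- l" a] by (simp add: zsmul_minus_left)

lemma zsmul_sum: "zsmul k (sum f A) = (\<Sum>a\<in>A. zsmul k (f a))"
  by (rule zmod.scale_sum_right)

context kac_moody_root_datum
begin

abbreviation pr :: "'p \<Rightarrow> 'q \<Rightarrow> int" where "pr \<equiv> pairing D"
abbreviation I :: "'i set" where "I \<equiv> index D"
abbreviation rt :: "'i \<Rightarrow> 'p" where "rt \<equiv> simple_root D"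
abbreviation crt :: "'i \<Rightarrow> 'q" where "crt \<equiv> simple_coroot D"
abbreviation srefl :: "'i \<Rightarrow> 'q \<Rightarrow> 'q" where "srefl \<equiv> simple_reflection D"
abbreviation W :: "('q \<Rightarrow> 'q) set" where "W \<equiv> weyl_group D"
abbreviation len :: "('q \<Rightarrow> 'q) \<Rightarrow> nat" where "len \<equiv> word_length D"
abbreviation act :: "('q \<Rightarrow> 'q) \<Rightarrow> 'p \<Rightarrow> 'p" where "act \<equiv> weight_act D"
abbreviation pos :: "'p set" where "pos \<equiv> pos_roots D"

lemma finite_I: "finite I"
  using cartan by (simp add: generalized_cartan_matrix_def)

lemmas pr_add_left = additive.add[OF pairing_additive_left]
  and pr_diff_left = additive.diff[OF pairing_additive_left]
  and pr_minus_left = additive.minus[OF pairing_additive_left]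
  and pr_zero_left = additive.zero[OF pairing_additive_left]
  and pr_sum_left = additive.sum[OF pairing_additive_left]
  and pr_add_right = additive.add[OF pairing_additive_right]
  and pr_diff_right = additive.diff[OF pairing_additive_right]
  and pr_minus_right = additive.minus[OF pairing_additive_right]
  and pr_zero_right = additive.zero[OF pairing_additive_right]
  and pr_sum_right = additive.sum[OF pairing_additive_right]

lemma pr_zsmul_left: "pr (zsmul k \<theta>) \<mu> = k * pr \<theta> \<mu>"
  using additive_zsmul[OF pairing_additive_left] by simp

lemma pr_zsmul_right: "pr \<theta> (zsmul k \<mu>) = k * pr \<theta> \<mu>"
  using additive_zsmul[OF pairing_additive_right] by simp

lemmas pr_simps = pr_add_left pr_diff_left pr_minus_left pr_zero_left pr_zsmul_left
  pr_add_right pr_diff_right pr_minus_right pr_zero_right pr_zsmul_right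

lemma weight_eqI: "(\<And>\<mu>. pr \<theta> \<mu> = pr \<theta>' \<mu>) \<Longrightarrow> \<theta> = \<theta>'"
  using pairing_perfect_right[OF pairing_additive_right[of \<theta>]] by auto

lemma coweight_eqI: "(\<And>\<theta>. pr \<theta> \<mu> = pr \<theta> \<mu>') \<Longrightarrow> \<mu> = \<mu>'"
  using pairing_perfect_left[OF pairing_additive_left[of \<mu>]] by auto

lemma pr_rt_crt: "i \<in> I \<Longrightarrow> j \<in> I \<Longrightarrow> pr (rt j) (crt i) = cartan D i j"
  by (rule pairing_simple)

lemma cartan_diag: "i \<in> I \<Longrightarrow> cartan D i i = 2"
  using cartan by (simp add: generalized_cartan_matrix_def)

lemma cartan_off_diag: "i \<in> I \<Longrightarrow> j \<in> I \<Longrightarrow> i \<noteq> j \<Longrightarrow> cartan D i j \<le> 0"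
  using cartan by (simp add: generalized_cartan_matrix_def)

lemma cartan_zero_sym: "i \<in> I \<Longrightarrow> j \<in> I \<Longrightarrow> cartan D i j = 0 \<longleftrightarrow> cartan D j i = 0"
  using cartan by (simp add: generalized_cartan_matrix_def)

section \<open>Coefficients with respect to simple roots and simple coroots\<close>

lemma independent_family_eq:
  fixes f :: "'i \<Rightarrow> 'a::ab_group_add"
  assumes inj: "inj_on f I" and ind: "zmod.independent (f ` I)"
    and eq: "(\<Sum>i\<in>I. zsmul (c i) (f i)) = (\<Sum>i\<in>I. zsmul (d i) (f i))" and "j \<in> I"
  shows "c j = d j"
proof -
  let ?g = "the_inv_into I f"
  have "(\<Sum>v\<in>f ` I. zsmul (c (?g v) - d (?g v)) v) = (\<Sum>i\<in>I. zsmul (c i - d i) (f i))"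
    by (simp add: sum.reindex[OF inj] the_inv_into_f_f[OF inj])
  also have "\<dots> = 0" using eq by (simp add: zsmul_diff_left sum_subtractf)
  finally have "c (?g (f j)) - d (?g (f j)) = 0"
    by (rule zmod.independentD[OF ind finite_imageI[OF finite_I] subset_refl])
      (use \<open>j \<in> I\<close> in simp)
  then show ?thesis by (simp add: the_inv_into_f_f[OF inj \<open>j \<in> I\<close>])
qed

lemmas rt_coeffs_eq = independent_family_eq[OF simple_roots_independent]

text \<open>The family is a parameter so that roots and coroots share the closure properties; their
  signs are later established together.\<close>

definition nonneg_comb :: "('i \<Rightarrow> 'a::ab_group_add) \<Rightarrow> 'a \<Rightarrow> bool" where
  "nonneg_comb f \<theta> \<longleftrightarrow> (\<exists>n :: 'i \<Rightarrow> nat. \<theta> = (\<Sum>i\<in>I. zsmul (int (n i)) (f i)))"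

lemma sum_single: "j \<in> I \<Longrightarrow> (\<Sum>i\<in>I. zsmul (if i = j then k else 0) (f i)) = zsmul k (f j)"
  using finite_I by (simp add: zsmul_0 if_distrib[of "\<lambda>k. zsmul k _"] cong: if_cong)

lemma nonneg_comb_int:
  assumes "\<And>i. i \<in> I \<Longrightarrow> 0 \<le> c i"
  shows "nonneg_comb f (\<Sum>i\<in>I. zsmul (c i) (f i))"
  unfolding nonneg_comb_def
  by (rule exI[of _ "\<lambda>i. nat (c i)"]) (use assms in \<open>simp cong: sum.cong\<close>)

lemma nonneg_comb_gen: "j \<in> I \<Longrightarrow> nonneg_comb f (f j)"
  using nonneg_comb_int[of "\<lambda>i. if i = j then 1 else 0" f] by (simp add: sum_single)

lemma nonneg_comb_add:
  "nonneg_comb f a \<Longrightarrow> nonneg_comb f b \<Longrightarrow> nonneg_comb f (a + b)"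
  unfolding nonneg_comb_def
proof (elim exE)
  fix m n :: "'i \<Rightarrow> nat"
  assume "a = (\<Sum>i\<in>I. zsmul (int (m i)) (f i))" "b = (\<Sum>i\<in>I. zsmul (int (n i)) (f i))"
  then show "\<exists>n. a + b = (\<Sum>i\<in>I. zsmul (int (n i)) (f i))"
    by (intro exI[of _ "\<lambda>i. m i + n i"]) (simp add: zsmul_add_left sum.distrib)
qed

lemma nonneg_comb_zsmul:
  assumes "nonneg_comb f a" "0 \<le> k"
  shows "nonneg_comb f (zsmul k a)"
proof -
  from assms obtain n :: "'i \<Rightarrow> nat" where a: "a = (\<Sum>i\<in>I. zsmul (int (n i)) (f i))"
    unfolding nonneg_comb_def by blast
  have "zsmul k a = (\<Sum>i\<in>I. zsmul (k * int (n i)) (f i))"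
    unfolding a by (simp add: zsmul_sum zsmul_mult)
  then show ?thesis using nonneg_comb_int[of "\<lambda>i. k * int (n i)" f] assms by simp
qed

lemma nonneg_comb_antisym:
  assumes inj: "inj_on f I" and ind: "zmod.independent (f ` I)"
    and "nonneg_comb f a" "nonneg_comb f (- a)"
  shows "a = 0"
proof -
  from assms obtain m n :: "'i \<Rightarrow> nat" where a: "a = (\<Sum>i\<in>I. zsmul (int (m i)) (f i))"
    and b: "- a = (\<Sum>i\<in>I. zsmul (int (n i)) (f i))" unfolding nonneg_comb_def by blast
  have "(\<Sum>i\<in>I. zsmul (int (m i) + int (n i)) (f i)) = a + - a"
    unfolding zsmul_add_left sum.distrib a[symmetric] b[symmetric] by simp
  then have "(\<Sum>i\<in>I. zsmul (int (m i) + int (n i)) (f i)) = (\<Sum>i\<in>I. zsmul 0 (f i))"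
    by (simp add: zsmul_0)
  from independent_family_eq[OF inj ind this] have "m i = 0" if "i \<in> I" for i
    using that by fastforce
  then show ?thesis unfolding a by (simp add: zsmul_0)
qed


section \<open>The Weyl group\<close>

lemma additive_srefl: "additive (srefl i)"
  by unfold_locales (simp add: simple_reflection_def pr_simps zsmul_add_left)

lemma srefl_srefl: "i \<in> I \<Longrightarrow> srefl i (srefl i \<mu>) = \<mu>"
proof -
  assume i: "i \<in> I"
  have "pr (rt i) \<mu> - 2 * pr (rt i) \<mu> = - pr (rt i) \<mu>" by simp
  then show ?thesis using i
    by (simp add: simple_reflection_def pr_simps pr_rt_crt cartan_diag zsmul_minus_left)
qed

lemma srefl_comp_srefl [simp]: "i \<in> I \<Longrightarrow> srefl i \<circ> srefl i = id"
  by (rule ext) (simp add: srefl_srefl)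

lemma word_prod_Nil [simp]: "word_prod D [] = id"
  and word_prod_Cons [simp]: "word_prod D (i # is) = srefl i \<circ> word_prod D is"
  by (simp_all add: word_prod_def)

lemma word_prod_append: "word_prod D (is @ js) = word_prod D is \<circ> word_prod D js"
  by (induction "is") (simp_all add: o_assoc)

lemma word_prod_rev:
  "is \<in> lists I \<Longrightarrow> word_prod D (rev is) \<circ> word_prod D is = id"
proof (induction "is")
  case (Cons i "is")
  then show ?case by (simp add: word_prod_append srefl_srefl fun_eq_iff)
qed simp

lemma rev_in_lists [simp]: "rev is \<in> lists A \<longleftrightarrow> is \<in> lists A"
  by (simp add: in_lists_conv_set)

lemma append_in_lists: "is \<in> lists A \<Longrightarrow> js \<in> lists A \<Longrightarrow> is @ js \<in> lists A"
  by simp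

lemma W_word: "is \<in> lists I \<Longrightarrow> word_prod D is \<in> W"
  by (simp add: weyl_group_def)

lemma W_id [simp]: "id \<in> W"
  using W_word[of "[]"] by simp

lemma W_comp [simp]: "w \<in> W \<Longrightarrow> w' \<in> W \<Longrightarrow> w \<circ> w' \<in> W"
  unfolding weyl_group_def
  by (auto simp del: append_in_lists_conv simp flip: word_prod_append intro!: imageI append_in_lists)

lemma W_srefl [simp]: "i \<in> I \<Longrightarrow> srefl i \<in> W"
  using W_word[of "[i]"] by simp

lemma W_inverse:
  assumes "w \<in> W"
  shows "inv w \<in> W" "inv w \<circ> w = id" "w \<circ> inv w = id" "bij w"
proof -
  from assms obtain "is" where "is": "is \<in> lists I" "w = word_prod D is"
    by (auto simp: weyl_group_def)
  let ?v = "word_prod D (rev is)"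
  have 1: "?v \<circ> w = id" using "is" word_prod_rev by simp
  have 2: "w \<circ> ?v = id" using "is" word_prod_rev[of "rev is"] by simp
  show "bij w" using o_bij[OF 1 2] .
  have "inv w = ?v" using 1 2 by (intro inv_unique_comp)
  then show "inv w \<in> W" "inv w \<circ> w = id" "w \<circ> inv w = id"
    using "is" 1 2 by (auto intro: W_word)
qed

lemmas W_inv [simp] = W_inverse(1)

lemma W_inv_apply [simp]:
  assumes "w \<in> W"
  shows "inv w (w \<mu>) = \<mu>" "w (inv w \<mu>) = \<mu>"
  using W_inverse(2,3)[OF assms] by (simp_all add: fun_eq_iff)

lemma W_inv_inv [simp]: "w \<in> W \<Longrightarrow> inv (inv w) = w"
  using W_inverse(4) by (rule inv_inv_eq)

lemma W_inv_comp: "w \<in> W \<Longrightarrow> w' \<in> W \<Longrightarrow> inv (w \<circ> w') = inv w' \<circ> inv w"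
  using W_inverse(4) by (intro o_inv_distrib)

lemma inv_srefl [simp]: "i \<in> I \<Longrightarrow> inv (srefl i) = srefl i"
  by (rule inv_unique_comp) simp_all

lemma additive_W: "w \<in> W \<Longrightarrow> additive w"
proof -
  have "additive (word_prod D is)" for "is"
  proof (induction "is")
    case (Cons i "is")
    show ?case
      by unfold_locales
        (simp add: additive.add[OF Cons.IH] additive.add[OF additive_srefl])
  qed (simp add: additive_def)
  then show "w \<in> W \<Longrightarrow> additive w" by (auto simp: weyl_group_def)
qed

lemmas W_add = additive.add[OF additive_W]
  and W_diff = additive.diff[OF additive_W]
  and W_zero = additive.zero[OF additive_W]
  and W_zsmul = zsmul_additive[OF additive_W]

lemma act_unique:
  assumes "w \<in> W" and "\<And>\<mu>. pr \<gamma> (w \<mu>) = pr \<beta> \<mu>"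
  shows "act w \<beta> = \<gamma>"
  unfolding weight_act_def
proof (rule the_equality)
  show "\<gamma>' = \<gamma>" if "\<forall>\<mu>. pr \<gamma>' (w \<mu>) = pr \<beta> \<mu>" for \<gamma>'
    using that assms by (intro weight_eqI) (metis W_inv_apply(2))
qed (simp add: assms)

text \<open>Perfectness of the pairing represents the additive function
  \<open>\<lambda>\<mu>. pr \<beta> (inv w \<mu>)\<close> by a weight, so the definite description
  in \<open>weight_act\<close> denotes.\<close>

lemma pr_act:
  assumes "w \<in> W"
  shows "pr (act w \<beta>) \<mu> = pr \<beta> (inv w \<mu>)"
proof -
  have "additive (\<lambda>\<mu>. pr \<beta> (inv w \<mu>))"
    by unfold_locales (simp add: W_add assms pr_add_right)
  from pairing_perfect_right[OF this]
  obtain \<gamma> where \<gamma>: "\<And>\<mu>. pr \<beta> (inv w \<mu>) = pr \<gamma> \<mu>" by blast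
  have "act w \<beta> = \<gamma>" by (rule act_unique) (use assms in \<open>simp_all flip: \<gamma>\<close>)
  then show ?thesis by (simp add: \<gamma>)
qed

lemma act_comp: "w \<in> W \<Longrightarrow> w' \<in> W \<Longrightarrow> act (w \<circ> w') \<beta> = act w (act w' \<beta>)"
  by (rule weight_eqI) (simp add: pr_act W_inv_comp)

lemma act_id [simp]: "act id \<beta> = \<beta>"
  by (rule weight_eqI) (simp add: pr_act)

lemma additive_act: "w \<in> W \<Longrightarrow> additive (act w)"
  by unfold_locales (rule weight_eqI, simp add: pr_act pr_simps)

lemmas act_add = additive.add[OF additive_act]
  and act_diff = additive.diff[OF additive_act]
  and act_minus = additive.minus[OF additive_act]
  and act_zero = additive.zero[OF additive_act]
  and act_zsmul = zsmul_additive[OF additive_act]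

lemma act_inv_act [simp]:
  assumes "w \<in> W"
  shows "act (inv w) (act w \<beta>) = \<beta>" "act w (act (inv w) \<beta>) = \<beta>"
  using assms W_inverse by (simp_all flip: act_comp)

lemma act_srefl:
  "i \<in> I \<Longrightarrow> act (srefl i) \<beta> = \<beta> - zsmul (pr \<beta> (crt i)) (rt i)"
  by (rule weight_eqI)
    (simp add: pr_act pr_simps simple_reflection_def algebra_simps)

lemma act_srefl_rt: "i \<in> I \<Longrightarrow> act (srefl i) (rt i) = - rt i"
  by (rule weight_eqI)
    (simp add: act_srefl pr_simps pr_rt_crt cartan_diag)

lemma act_srefl_srefl [simp]: "i \<in> I \<Longrightarrow> act (srefl i) (act (srefl i) \<beta>) = \<beta>"
  using act_inv_act(1)[of "srefl i"] by simp


section \<open>Word length\<close>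

lemma reduced_word:
  assumes "w \<in> W"
  obtains "is" where "is \<in> lists I" "word_prod D is = w" "length is = len w"
proof -
  have "\<exists>n. \<exists>is\<in>lists I. word_prod D is = w \<and> length is = n"
    using assms by (auto simp: weyl_group_def)
  from LeastI_ex[OF this] show thesis
    using that unfolding word_length_def by blast
qed

lemma len_le: "is \<in> lists I \<Longrightarrow> len (word_prod D is) \<le> length is"
  unfolding word_length_def by (rule Least_le) blast

lemma len_id [simp]: "len id = 0"
  using len_le[of "[]"] by simp

lemma len_comp_le:
  assumes "w \<in> W" "w' \<in> W"
  shows "len (w \<circ> w') \<le> len w + len w'"
proof -
  obtain "is" where "is": "is \<in> lists I" "word_prod D is = w" "length is = len w"
    using reduced_word[OF assms(1)] .
  obtain js where js: "js \<in> lists I" "word_prod D js = w'" "length js = len w'"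
    using reduced_word[OF assms(2)] .
  show ?thesis using len_le[of "is @ js"] "is" js by (simp add: word_prod_append)
qed

lemma len_inv [simp]:
  assumes "w \<in> W"
  shows "len (inv w) = len w"
proof -
  have *: "len (inv v) \<le> len v" if v: "v \<in> W" for v
  proof -
    obtain "is" where "is": "is \<in> lists I" "word_prod D is = v" "length is = len v"
      using reduced_word[OF v] .
    have "word_prod D (rev is) \<circ> v = id" "v \<circ> word_prod D (rev is) = id"
      using word_prod_rev[of "is"] word_prod_rev[of "rev is"] "is" by simp_all
    then have "inv v = word_prod D (rev is)" by (intro inv_unique_comp)
    then show ?thesis using len_le[of "rev is"] "is" by simp
  qed
  show ?thesis using *[OF assms] *[OF W_inv[OF assms]] assms by simp
qed

lemma len_srefl_le: "i \<in> I \<Longrightarrow> len (srefl i) \<le> 1"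
  using len_le[of "[i]"] by simp

lemma comp_srefl_cancel [simp]: "i \<in> I \<Longrightarrow> w \<circ> srefl i \<circ> srefl i = w"
  by (simp add: comp_assoc)

lemma len_comp_srefl_le: "w \<in> W \<Longrightarrow> i \<in> I \<Longrightarrow> len (w \<circ> srefl i) \<le> Suc (len w)"
  using len_comp_le[of w "srefl i"] len_srefl_le[of i] by simp

lemma len_le_comp_srefl: "w \<in> W \<Longrightarrow> i \<in> I \<Longrightarrow> len w \<le> Suc (len (w \<circ> srefl i))"
  using len_comp_srefl_le[of "w \<circ> srefl i" i] by simp

lemma right_descent_exists:
  assumes "w \<in> W" "w \<noteq> id"
  obtains i where "i \<in> I" "Suc (len (w \<circ> srefl i)) = len w"
proof -
  obtain "is" where "is": "is \<in> lists I" "word_prod D is = w" "length is = len w"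
    using reduced_word[OF assms(1)] .
  with assms(2) obtain js i where js: "is = js @ [i]" by (cases "is" rule: rev_cases) auto
  have *: "i \<in> I" "js \<in> lists I" using js "is" by auto
  have "word_prod D js = w \<circ> srefl i"
    using "is"(2) * unfolding js by (auto simp: word_prod_append)
  then have "len (w \<circ> srefl i) \<le> length js" using len_le[OF *(2)] by simp
  then have "len (w \<circ> srefl i) + 1 \<le> len w" using "is"(3) js by simp
  then show thesis using that[OF *(1)] len_le_comp_srefl[OF assms(1) *(1)] by simp
qed

end

section \<open>Sign of the image of a simple root\<close>

text \<open>The word of length \<open>k\<close> ending in \<open>t\<close>. It grows on the left, so
  that images of \<open>s\<close> can be computed recursively and shorter words are suffixes of
  longer ones.\<close>

primrec alt :: "'a \<Rightarrow> 'a \<Rightarrow> nat \<Rightarrow> 'a list" where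
  "alt s t 0 = []"
| "alt s t (Suc k) = (if even k then t else s) # alt s t k"

lemma length_alt [simp]: "length (alt s t k) = k"
  by (induction k) auto

lemma set_alt: "set (alt s t k) \<subseteq> {s, t}"
  by (induction k) auto

lemma alt_add: "\<exists>c. alt s t (j + m) = c @ alt s t m \<and> set c \<subseteq> {s, t} \<and> length c = j"
proof (induction j)
  case (Suc j)
  then obtain c where "alt s t (j + m) = c @ alt s t m" "set c \<subseteq> {s, t}" "length c = j"
    by blast
  then show ?case
    by (intro exI[of _ "(if even (j + m) then t else s) # c"]) auto
qed simp

lemma alt_Suc_snoc: "\<exists>c. alt s t (Suc m) = c @ [t] \<and> set c \<subseteq> {s, t} \<and> length c = m"
  using alt_add[of s t m 1] by auto

lemma distinct_adj_eq_alt: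
  assumes "distinct_adj c" "set c \<subseteq> {s, t}" "c \<noteq> [] \<longrightarrow> last c = t" "s \<noteq> t"
  shows "c = alt s t (length c)"
  using assms(1-3)
proof (induction c)
  case (Cons x c)
  show ?case
  proof (cases c)
    case Nil
    then show ?thesis using Cons.prems by simp
  next
    case (Cons y d)
    then have c: "c = alt s t (Suc (length d))" using Cons.IH Cons.prems by auto
    have "x \<noteq> y" "x \<in> {s, t}" using Cons.prems \<open>c = y # d\<close> by auto
    moreover have "y = (if even (length d) then t else s)" using c \<open>c = y # d\<close> by auto
    ultimately have "x = (if even (length c) then t else s)"
      using \<open>c = y # d\<close> by auto
    then show ?thesis using c \<open>c = y # d\<close> by simp
  qed
qed simp

text \<open>The coefficients of the image of the simple root \<open>s\<close> under the alternating word of length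
  \<open>k\<close> that ends in \<open>t\<close>, in a rank two root system with off-diagonal Cartan entries \<open>-a\<close>, \<open>-b\<close>.\<close>

primrec alt_coeffs :: "int \<Rightarrow> int \<Rightarrow> nat \<Rightarrow> int \<times> int" where
  "alt_coeffs a b 0 = (1, 0)"
| "alt_coeffs a b (Suc k) = (case alt_coeffs a b k of (p, q) \<Rightarrow>
     if even k then (p, b * p - q) else (a * q - p, q))"

text \<open>That is, \<open>k\<close> is less than the order of the product of the two simple reflections.\<close>

definition dihedral_bound :: "int \<Rightarrow> int \<Rightarrow> nat \<Rightarrow> bool" where
  "dihedral_bound a b k \<longleftrightarrow> a * b \<ge> 4 \<or> (a * b = 0 \<and> k < 2) \<or> (a * b = 1 \<and> k < 3) \<or>
     (a * b = 2 \<and> k < 4) \<or> (a * b = 3 \<and> k < 6)"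

lemma dihedral_bound_commute: "dihedral_bound a b = dihedral_bound b a"
  by (rule ext) (simp add: dihedral_bound_def mult.commute)

text \<open>Nonnegativity alone does not survive the subtractions in \<open>alt_coeffs\<close>, so a
  bound on the ratio is carried along. Multiplying \<open>a * q \<le> 2 * p\<close> by
  \<open>b\<close> and using \<open>a * b \<ge> 4\<close> gives \<open>2 * q \<le> b * p\<close>,
  which yields both the next coefficient and the next ratio bound.\<close>

lemma alt_coeffs_nonneg_infinite:
  assumes "a > 0" "b > 0" "a * b \<ge> 4" "alt_coeffs a b k = (p, q)"
  shows "0 \<le> p \<and> 0 \<le> q \<and> (if even k then a * q \<le> 2 * p else b * p \<le> 2 * q)"
  using assms(4)
proof (induction k arbitrary: p q)
  case (Suc k)
  obtain p' q' where pq: "alt_coeffs a b k = (p', q')" by fastforce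
  note IH = Suc.IH[OF pq]
  show ?case
  proof (cases "even k")
    case True
    then have "p = p'" "q = b * p' - q'" using Suc.prems pq by auto
    moreover have "a * q' \<le> 2 * p'" "0 \<le> p'" "0 \<le> q'" using IH True by auto
    moreover have "b * (a * q') \<le> b * (2 * p')" using calculation assms by (intro mult_left_mono) auto
    moreover have "4 * q' \<le> (a * b) * q'" using calculation assms by (intro mult_right_mono) auto
    moreover have "0 \<le> b * p'" using calculation assms by simp
    ultimately show ?thesis using True by (auto simp: algebra_simps)
  next
    case False
    then have "q = q'" "p = a * q' - p'" using Suc.prems pq by auto
    moreover have "b * p' \<le> 2 * q'" "0 \<le> p'" "0 \<le> q'" using IH False by auto
    moreover have "a * (b * p') \<le> a * (2 * q')" using calculation assms by (intro mult_left_mono) auto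
    moreover have "4 * p' \<le> (a * b) * p'" using calculation assms by (intro mult_right_mono) auto
    moreover have "0 \<le> a * q'" using calculation assms by simp
    ultimately show ?thesis using False by (auto simp: algebra_simps)
  qed
qed auto

text \<open>These are the rank two types A1 x A1, A2, B2 and G2, the last two in both
  orientations.\<close>

lemma small_product_cases:
  fixes a b :: int
  assumes "0 \<le> a" "0 \<le> b" "a = 0 \<longleftrightarrow> b = 0" "a * b < 4"
  obtains "a = 0" "b = 0" | "a = 1" "b = 1" | "a = 1" "b = 2" | "a = 2" "b = 1"
    | "a = 1" "b = 3" | "a = 3" "b = 1"
proof -
  consider "a = 0" "b = 0" | "1 \<le> a" "1 \<le> b" using assms by force
  then show thesis
  proof cases
    case 2
    have "a \<le> a * b" "b \<le> a * b" using 2 by auto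
    then have "a < 4" "b < 4" using assms(4) by linarith+
    then have "a \<in> {1, 2, 3}" "b \<in> {1, 2, 3}" using 2 by auto
    then show ?thesis using assms(4) that by auto
  qed (use that in simp)
qed

lemma alt_coeffs_nonneg:
  assumes "0 \<le> a" "0 \<le> b" "a = 0 \<longleftrightarrow> b = 0" "dihedral_bound a b k" "alt_coeffs a b k = (p, q)"
  shows "0 \<le> p" "0 \<le> q"
proof -
  have "0 \<le> p \<and> 0 \<le> q"
  proof (cases "a * b \<ge> 4")
    case True
    then have "a > 0" "b > 0" using assms by (auto simp: order.order_iff_strict)
    then show ?thesis using alt_coeffs_nonneg_infinite[OF _ _ True assms(5)] by blast
  next
    case False
    \<comment> \<open>In the finite types the bound on \<open>k\<close> is at most 6. The values are
      spelled in successor form so that the recursion evaluates.\<close>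
    have k: "k \<in> {0, Suc 0, Suc (Suc 0), Suc (Suc (Suc 0)), Suc (Suc (Suc (Suc 0))),
        Suc (Suc (Suc (Suc (Suc 0))))}" using assms(4) False by (auto simp: dihedral_bound_def)
    from assms(1-3) have "a * b < 4 \<Longrightarrow> ?thesis"
      by (cases rule: small_product_cases)
        (use assms(4,5) k in \<open>auto simp: dihedral_bound_def\<close>)
    then show ?thesis using False by simp
  qed
  then show "0 \<le> p" "0 \<le> q" by auto
qed

context kac_moody_root_datum
begin

lemma act_alt_rt:
  assumes "s \<in> I" "t \<in> I" "alt_coeffs (- cartan D s t) (- cartan D t s) k = (p, q)"
  shows "act (word_prod D (alt s t k)) (rt s) = zsmul p (rt s) + zsmul q (rt t)"
  using assms(3)
proof (induction k arbitrary: p q)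
  case (Suc k)
  obtain p' q' where pq: "alt_coeffs (- cartan D s t) (- cartan D t s) k = (p', q')" by fastforce
  have *: "word_prod D (alt s t k) \<in> W"
    using set_alt[of s t k] assms by (intro W_word) auto
  show ?case
  proof (cases "even k")
    case True
    with Suc.prems pq have [simp]: "p = p'" "q = - cartan D t s * p' - q'" by auto
    have eq: "act (word_prod D (alt s t (Suc k))) (rt s) = act (srefl t) (zsmul p' (rt s) + zsmul q' (rt t))"
      using True assms(2) * Suc.IH[OF pq] by (simp only: alt.simps if_True word_prod_Cons act_comp W_srefl)
    show ?thesis unfolding eq using assms(1,2)
      by (intro weight_eqI) (simp add: act_srefl pr_simps pr_rt_crt cartan_diag algebra_simps)
  next
    case False
    with Suc.prems pq have [simp]: "q = q'" "p = - cartan D s t * q' - p'" by auto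
    have eq: "act (word_prod D (alt s t (Suc k))) (rt s) = act (srefl s) (zsmul p' (rt s) + zsmul q' (rt t))"
      using False assms(1) * Suc.IH[OF pq] by (simp only: alt.simps if_False word_prod_Cons act_comp W_srefl)
    show ?thesis unfolding eq using assms(1,2)
      by (intro weight_eqI) (simp add: act_srefl pr_simps pr_rt_crt cartan_diag algebra_simps)
  qed
qed (simp add: zsmul_0)

text \<open>Coroots transform by the transposed Cartan matrix, hence the two parameters of
  \<open>alt_coeffs\<close> are interchanged.\<close>

lemma alt_crt:
  assumes "s \<in> I" "t \<in> I" "alt_coeffs (- cartan D t s) (- cartan D s t) k = (p, q)"
  shows "word_prod D (alt s t k) (crt s) = zsmul p (crt s) + zsmul q (crt t)"
  using assms(3)
proof (induction k arbitrary: p q)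
  case (Suc k)
  obtain p' q' where pq: "alt_coeffs (- cartan D t s) (- cartan D s t) k = (p', q')" by fastforce
  show ?case
  proof (cases "even k")
    case True
    with Suc.prems pq have [simp]: "p = p'" "q = - cartan D s t * p' - q'" by auto
    show ?thesis using True assms(1,2) Suc.IH[OF pq]
      by (intro coweight_eqI)
        (simp add: simple_reflection_def pr_simps pr_rt_crt cartan_diag algebra_simps)
  next
    case False
    with Suc.prems pq have [simp]: "q = q'" "p = - cartan D t s * q' - p'" by auto
    show ?thesis using False assms(1,2) Suc.IH[OF pq]
      by (intro coweight_eqI)
        (simp add: simple_reflection_def pr_simps pr_rt_crt cartan_diag algebra_simps)
  qed
qed (simp add: zsmul_0)

text \<open>Once \<open>k\<close> reaches the order 2, 3, 4 or 6 of the product of the two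
  reflections, the braid relation of that order is available; it is checked by evaluating both words
  on an arbitrary coweight.\<close>

lemma braid_relation:
  assumes "s \<in> I" "t \<in> I" "s \<noteq> t" "\<not> dihedral_bound (- cartan D s t) (- cartan D t s) k"
  obtains m where "Suc m \<le> k" "word_prod D (alt s t (Suc m)) = word_prod D (alt t s (Suc m))"
proof -
  let ?a = "- cartan D s t" and ?b = "- cartan D t s"
  have ab: "0 \<le> ?a" "0 \<le> ?b" "?a = 0 \<longleftrightarrow> ?b = 0"
    using cartan_off_diag cartan_zero_sym assms by auto
  have lt: "?a * ?b < 4" using assms(4) by (simp add: dihedral_bound_def)
  note simps = assms(1,2) simple_reflection_def pr_simps pr_rt_crt cartan_diag
  from ab lt show thesis
  proof (cases rule: small_product_cases)
    case 1
    then have c: "cartan D s t = 0" "cartan D t s = 0" by auto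
    have "word_prod D (alt s t (Suc (Suc 0))) = word_prod D (alt t s (Suc (Suc 0)))"
      by (intro ext coweight_eqI) (simp add: c simps)
    moreover have "Suc (Suc 0) \<le> k" using assms(4) c by (auto simp: dihedral_bound_def)
    ultimately show ?thesis using that by blast
  next
    case 2
    then have c: "cartan D s t = -1" "cartan D t s = -1" by auto
    have "word_prod D (alt s t (Suc (Suc (Suc 0)))) = word_prod D (alt t s (Suc (Suc (Suc 0))))"
      by (intro ext coweight_eqI) (simp add: c simps algebra_simps)
    moreover have "Suc (Suc (Suc 0)) \<le> k" using assms(4) c by (auto simp: dihedral_bound_def)
    ultimately show ?thesis using that by blast
  next
    case 3
    then have c: "cartan D s t = -1" "cartan D t s = -2" by auto
    have "word_prod D (alt s t (Suc (Suc (Suc (Suc 0))))) = word_prod D (alt t s (Suc (Suc (Suc (Suc 0)))))"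
      by (intro ext coweight_eqI) (simp add: c simps algebra_simps)
    moreover have "Suc (Suc (Suc (Suc 0))) \<le> k" using assms(4) c by (auto simp: dihedral_bound_def)
    ultimately show ?thesis using that by blast
  next
    case 4
    then have c: "cartan D s t = -2" "cartan D t s = -1" by auto
    have "word_prod D (alt s t (Suc (Suc (Suc (Suc 0))))) = word_prod D (alt t s (Suc (Suc (Suc (Suc 0)))))"
      by (intro ext coweight_eqI) (simp add: c simps algebra_simps)
    moreover have "Suc (Suc (Suc (Suc 0))) \<le> k" using assms(4) c by (auto simp: dihedral_bound_def)
    ultimately show ?thesis using that by blast
  next
    case 5
    then have c: "cartan D s t = -1" "cartan D t s = -3" by auto
    have "word_prod D (alt s t (Suc (Suc (Suc (Suc (Suc (Suc 0))))))) = word_prod D (alt t s (Suc (Suc (Suc (Suc (Suc (Suc 0)))))))"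
      by (intro ext coweight_eqI) (simp add: c simps algebra_simps)
    moreover have "Suc (Suc (Suc (Suc (Suc (Suc 0))))) \<le> k" using assms(4) c by (auto simp: dihedral_bound_def)
    ultimately show ?thesis using that by blast
  next
    case 6
    then have c: "cartan D s t = -3" "cartan D t s = -1" by auto
    have "word_prod D (alt s t (Suc (Suc (Suc (Suc (Suc (Suc 0))))))) = word_prod D (alt t s (Suc (Suc (Suc (Suc (Suc (Suc 0)))))))"
      by (intro ext coweight_eqI) (simp add: c simps algebra_simps)
    moreover have "Suc (Suc (Suc (Suc (Suc (Suc 0))))) \<le> k" using assms(4) c by (auto simp: dihedral_bound_def)
    ultimately show ?thesis using that by blast
  qed
qed

lemma reduced_distinct_adj:
  "c \<in> lists I \<Longrightarrow> length c \<le> len (word_prod D c) \<Longrightarrow> distinct_adj c"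
proof (induction c)
  case (Cons x c)
  have "len (word_prod D (x # c)) \<le> Suc (len (word_prod D c))"
    using len_comp_le[of "srefl x" "word_prod D c"] len_srefl_le[of x] Cons.prems(1) W_word[of c]
    by (auto simp del: comp_apply)
  from order_trans[OF Cons.prems(2) this] have "distinct_adj c"
    using Cons.IH Cons.prems(1) by simp
  moreover have "x \<noteq> y" if "c = y # d" for y d
  proof
    assume "x = y"
    then have "word_prod D (x # c) = word_prod D d"
      using Cons.prems(1) that by (simp add: fun_eq_iff srefl_srefl)
    then show False using Cons.prems len_le[of d] that by simp
  qed
  ultimately show ?case by (cases c) auto
qed simp

text \<open>Here \<open>v\<close> is the shortest representative of the coset of \<open>w\<close>
  modulo the subgroup generated by the two reflections. It is found by minimising
  \<open>len v\<close> among factorizations whose lengths add up.\<close>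

lemma dihedral_factorization:
  assumes "w \<in> W" "s \<in> I" "t \<in> I" "len w \<le> len (w \<circ> srefl s)" "Suc (len (w \<circ> srefl t)) = len w"
  obtains v k where "v \<in> W" "len v < len w" "len v \<le> len (v \<circ> srefl s)" "len v \<le> len (v \<circ> srefl t)"
    "w = v \<circ> word_prod D (alt s t k)" "dihedral_bound (- cartan D s t) (- cartan D t s) k"
proof -
  have st: "s \<noteq> t" using assms(4,5) by auto
  define P where "P = (\<lambda>(v, c). v \<in> W \<and> set c \<subseteq> {s, t} \<and> w = v \<circ> word_prod D c \<and>
    len v + length c = len w)"
  have "P (w \<circ> srefl t, [t])" using assms by (simp add: P_def fun_eq_iff srefl_srefl)
  from ex_has_least_nat[of P, OF this, of "\<lambda>(v, c). len v"]
  obtain v c where Pvc: "P (v, c)" and least: "\<And>v' c'. P (v', c') \<Longrightarrow> len v \<le> len v'"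
    by fast
  then have v: "v \<in> W" and c: "set c \<subseteq> {s, t}" and w: "w = v \<circ> word_prod D c"
    and l: "len v + length c = len w" by (auto simp: P_def)
  have cI: "c' \<in> lists I" if "set c' \<subseteq> {s, t}" for c' using that assms by auto
  have len_v: "len v < len w" using least[OF \<open>P (w \<circ> srefl t, [t])\<close>] assms(5) by simp
  \<comment> \<open>A descent of \<open>v\<close> at \<open>r\<close> could be moved into the word,
    giving an admissible factorization with a shorter first factor.\<close>
  have up: "len v \<le> len (v \<circ> srefl r)" if r: "r \<in> {s, t}" for r
  proof (rule ccontr)
    assume less: "\<not> len v \<le> len (v \<circ> srefl r)"
    have rI: "r \<in> I" using r assms by auto
    have eq: "w = (v \<circ> srefl r) \<circ> word_prod D (r # c)"
      unfolding w using rI by (simp add: fun_eq_iff srefl_srefl)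
    have "len w \<le> len (v \<circ> srefl r) + length (r # c)"
      unfolding eq using len_comp_le[of "v \<circ> srefl r" "word_prod D (r # c)"] len_le[of "r # c"]
        v rI cI[OF c] W_word[of "r # c"] by fastforce
    then have "P (v \<circ> srefl r, r # c)"
      using eq v rI r c less l by (auto simp: P_def)
    then show False using least less by blast
  qed
  have not_shorter: "w \<circ> srefl s \<noteq> v \<circ> word_prod D d" if "set d \<subseteq> {s, t}" "length d < length c" for d
    using len_comp_le[OF v W_word[OF cI[OF that(1)]]] len_le[OF cI[OF that(1)]] that(2) l assms(4)
    by auto
  have "len w \<le> len v + len (word_prod D c)"
    unfolding w by (rule len_comp_le[OF v W_word[OF cI[OF c]]])
  then have "distinct_adj c" using l by (intro reduced_distinct_adj cI c) simp
  \<comment> \<open>A word ending in \<open>s\<close> would make \<open>w \<circ> srefl s\<close>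
    shorter than \<open>w\<close>.\<close>
  moreover have "last c = t" if "c \<noteq> []"
  proof (rule ccontr)
    assume "last c \<noteq> t"
    then have "c = butlast c @ [s]" using that c
      by (metis append_butlast_last_id insert_iff last_in_set singletonD subsetD)
    then have "w \<circ> srefl s = v \<circ> word_prod D (butlast c)"
      unfolding w using assms(2)
      by (metis word_prod_append word_prod_Cons word_prod_Nil comp_id comp_assoc comp_srefl_cancel)
    moreover have "set (butlast c) \<subseteq> {s, t}" using c in_set_butlastD by fast
    ultimately show False using not_shorter[of "butlast c"] that by simp
  qed
  ultimately have alt: "c = alt s t (length c)" using c st by (intro distinct_adj_eq_alt) auto
  have "dihedral_bound (- cartan D s t) (- cartan D t s) (length c)"
  proof (rule ccontr)
    assume "\<not> ?thesis"
    \<comment> \<open>The braid relation rewrites the end of the word so that its last letter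
      becomes \<open>s\<close>, with the same contradiction.\<close>
    then obtain m where m: "Suc m \<le> length c"
      "word_prod D (alt s t (Suc m)) = word_prod D (alt t s (Suc m))"
      using braid_relation[OF assms(2,3) st] by blast
    obtain d where d: "c = d @ alt s t (Suc m)" "set d \<subseteq> {s, t}" "length d = length c - Suc m"
      using alt_add[of s t "length c - Suc m" "Suc m"] m(1) alt by (metis le_add_diff_inverse2)
    obtain e where e: "alt t s (Suc m) = e @ [s]" "set e \<subseteq> {s, t}" "length e = m"
      using alt_Suc_snoc[of t s m] by auto
    have "word_prod D c = word_prod D (d @ e) \<circ> srefl s"
      by (simp only: d(1) m(2) e(1) word_prod_append word_prod_Cons word_prod_Nil comp_id comp_assoc)
    then have "w \<circ> srefl s = v \<circ> word_prod D (d @ e)"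
      unfolding w using assms(2) by (metis comp_assoc comp_srefl_cancel)
    then show False using not_shorter[of "d @ e"] d(2,3) e(2,3) m(1) by auto
  qed
  then show thesis using that[of v "length c"] v len_v up w alt by auto
qed

text \<open>The rank two factor sends the simple root to a nonnegative combination of two simple
  roots, at both of which the shorter element \<open>v\<close> has no descent. The same
  factorization serves the coroot, so no comparison between roots and coroots is needed.\<close>

theorem simple_root_image_nonneg:
  assumes "w \<in> W" "i \<in> I" "len w \<le> len (w \<circ> srefl i)"
  shows "nonneg_comb rt (act w (rt i)) \<and> nonneg_comb crt (w (crt i))"
  using assms
proof (induction "len w" arbitrary: w i rule: less_induct)
  case less
  show ?case
  proof (cases "w = id")
    case True
    then show ?thesis using less.prems by (simp add: nonneg_comb_gen)
  next
    case False
    obtain j where j: "j \<in> I" "Suc (len (w \<circ> srefl j)) = len w"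
      using right_descent_exists[OF less.prems(1) False] .
    obtain v k where v: "v \<in> W" "len v < len w" "len v \<le> len (v \<circ> srefl i)"
        "len v \<le> len (v \<circ> srefl j)" and w: "w = v \<circ> word_prod D (alt i j k)"
      and bound: "dihedral_bound (- cartan D i j) (- cartan D j i) k"
      using dihedral_factorization[OF less.prems(1,2) j(1) less.prems(3) j(2)] .
    have alt_W: "word_prod D (alt i j k) \<in> W"
      using set_alt[of i j k] less.prems j by (intro W_word) auto
    have "i \<noteq> j" using less.prems(3) j by auto
    then have c: "0 \<le> - cartan D i j" "0 \<le> - cartan D j i"
        "- cartan D i j = 0 \<longleftrightarrow> - cartan D j i = 0"
      using cartan_off_diag cartan_zero_sym less.prems j by auto
    obtain p q where pq: "alt_coeffs (- cartan D i j) (- cartan D j i) k = (p, q)" by fastforce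
    obtain p' q' where pq': "alt_coeffs (- cartan D j i) (- cartan D i j) k = (p', q')" by fastforce
    note nonneg = alt_coeffs_nonneg[OF c bound pq]
      alt_coeffs_nonneg[OF c(2,1) c(3)[symmetric] bound[unfolded dihedral_bound_commute[of "- cartan D i j"]] pq']
    note IH = less.hyps[OF v(2,1) less.prems(2) v(3)] less.hyps[OF v(2,1) j(1) v(4)]
    have "act w (rt i) = zsmul p (act v (rt i)) + zsmul q (act v (rt j))"
      using v(1) alt_W act_alt_rt[OF less.prems(2) j(1) pq]
      by (simp add: w act_comp act_add act_zsmul)
    moreover have "w (crt i) = zsmul p' (v (crt i)) + zsmul q' (v (crt j))"
      using v(1) alt_crt[OF less.prems(2) j(1) pq'] by (simp add: w W_add W_zsmul)
    ultimately show ?thesis using IH nonneg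
      by (simp add: nonneg_comb_add nonneg_comb_zsmul)
  qed
qed

section \<open>Real roots, coroots and reflections\<close>

lemma pos_roots_alt: "\<beta> \<in> pos \<longleftrightarrow> \<beta> \<in> roots D \<and> nonneg_comb rt \<beta>"
  by (simp add: pos_roots_def nonneg_comb_def)

lemma pos_root: "\<beta> \<in> pos \<Longrightarrow> \<beta> \<in> roots D"
  by (simp add: pos_roots_alt)

lemma rootI: "w \<in> W \<Longrightarrow> i \<in> I \<Longrightarrow> act w (rt i) \<in> roots D"
  by (auto simp: roots_def)

lemma rootE:
  assumes "\<beta> \<in> roots D"
  obtains w i where "w \<in> W" "i \<in> I" "\<beta> = act w (rt i)"
  using assms by (auto simp: roots_def)

lemma act_root: "w \<in> W \<Longrightarrow> \<beta> \<in> roots D \<Longrightarrow> act w \<beta> \<in> roots D"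
  by (metis rootE rootI W_comp act_comp)

lemma act_comp_srefl_rt: "w \<in> W \<Longrightarrow> i \<in> I \<Longrightarrow> act (w \<circ> srefl i) (rt i) = - act w (rt i)"
  by (subst act_comp) (simp_all add: act_srefl_rt act_minus)

lemma minus_root: "\<beta> \<in> roots D \<Longrightarrow> - \<beta> \<in> roots D"
  by (metis rootE rootI W_comp W_srefl act_comp_srefl_rt)

lemma minus_root_iff [simp]: "- \<beta> \<in> roots D \<longleftrightarrow> \<beta> \<in> roots D"
  using minus_root[of \<beta>] minus_root[of "- \<beta>"] by auto

lemma root_nonzero: "\<beta> \<in> roots D \<Longrightarrow> \<beta> \<noteq> 0"
proof
  assume "\<beta> \<in> roots D" "\<beta> = 0"
  then obtain w i where w: "w \<in> W" "i \<in> I" "act w (rt i) = 0" by (metis rootE)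
  then have "rt i = 0" using act_inv_act(1)[of w "rt i"] by (simp add: act_zero)
  then show False using pr_rt_crt[of i i] cartan_diag[of i] w by (simp add: pr_simps)
qed

lemma rt_pos: "i \<in> I \<Longrightarrow> rt i \<in> pos"
  using rootI[of id i] by (simp add: pos_roots_alt nonneg_comb_gen)

lemma ascent_pos: "w \<in> W \<Longrightarrow> i \<in> I \<Longrightarrow> len w \<le> len (w \<circ> srefl i) \<Longrightarrow> act w (rt i) \<in> pos"
  using simple_root_image_nonneg by (simp add: pos_roots_alt rootI)

lemma descent_neg:
  assumes "w \<in> W" "i \<in> I" "len (w \<circ> srefl i) \<le> len w"
  shows "- act w (rt i) \<in> pos"
  using ascent_pos[of "w \<circ> srefl i" i] assms by (simp add: act_comp_srefl_rt del: comp_apply)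

lemma pos_not_neg: "\<beta> \<in> pos \<Longrightarrow> - \<beta> \<notin> pos"
  using nonneg_comb_antisym[OF simple_roots_independent, of \<beta>] root_nonzero[of \<beta>]
  by (auto simp: pos_roots_alt)

lemma pos_or_neg: "\<beta> \<in> roots D \<Longrightarrow> \<beta> \<in> pos \<or> - \<beta> \<in> pos"
  by (metis rootE ascent_pos descent_neg nle_le)

lemma neg_pos_iff: "\<beta> \<in> roots D \<Longrightarrow> - \<beta> \<in> pos \<longleftrightarrow> \<beta> \<notin> pos"
  using pos_or_neg pos_not_neg by blast

text \<open>The length cannot stay the same, for then the image of the simple root would be both
  positive and negative.\<close>

lemma act_rt_pos_iff:
  assumes "w \<in> W" "i \<in> I"
  shows "act w (rt i) \<in> pos \<longleftrightarrow> len (w \<circ> srefl i) = Suc (len w)"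
    and "act w (rt i) \<notin> pos \<longleftrightarrow> Suc (len (w \<circ> srefl i)) = len w"
proof -
  note up = ascent_pos[OF assms] and down = pos_not_neg[of "act w (rt i)"] descent_neg[OF assms]
  have le: "len (w \<circ> srefl i) \<le> Suc (len w)" "len w \<le> Suc (len (w \<circ> srefl i))"
    using len_comp_srefl_le len_le_comp_srefl assms by blast+
  have *: "(P \<longleftrightarrow> b = Suc a) \<and> (\<not> P \<longleftrightarrow> Suc b = a)"
    if "b \<le> Suc a" "a \<le> Suc b" "a \<le> b \<Longrightarrow> P" "b \<le> a \<Longrightarrow> \<not> P" for a b :: nat and P
    using that by (cases "a \<le> b"; cases "b \<le> a") auto
  show "act w (rt i) \<in> pos \<longleftrightarrow> len (w \<circ> srefl i) = Suc (len w)"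
    and "act w (rt i) \<notin> pos \<longleftrightarrow> Suc (len (w \<circ> srefl i)) = len w"
    using *[OF le] up down by blast+
qed

text \<open>The coefficients of a root all have the same sign, so a single positive one
  decides.\<close>

lemma root_coeff_pos:
  assumes "\<beta> \<in> roots D" "\<beta> = (\<Sum>i\<in>I. zsmul (c i) (rt i))" "j \<in> I" "0 < c j"
  shows "\<beta> \<in> pos"
proof (rule ccontr)
  assume "\<beta> \<notin> pos"
  then obtain n :: "'i \<Rightarrow> nat" where n: "- \<beta> = (\<Sum>i\<in>I. zsmul (int (n i)) (rt i))"
    using pos_or_neg[OF assms(1)] by (auto simp: pos_roots_alt nonneg_comb_def)
  have "(\<Sum>i\<in>I. zsmul (c i + int (n i)) (rt i)) = \<beta> + - \<beta>"
    unfolding zsmul_add_left sum.distrib assms(2)[symmetric] n[symmetric] by simp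
  then have "(\<Sum>i\<in>I. zsmul (c i + int (n i)) (rt i)) = (\<Sum>i\<in>I. zsmul 0 (rt i))" by simp
  from rt_coeffs_eq[OF this assms(3)] show False using assms(4) by simp
qed

lemma id_if_no_descent:
  assumes "w \<in> W" "\<And>i. i \<in> I \<Longrightarrow> act w (rt i) \<in> pos"
  shows "w = id"
  using right_descent_exists[OF assms(1)] assms act_rt_pos_iff(2)[OF assms(1)] by metis

text \<open>The product of the two reflections in the same root, with two candidate coroots, is a
  transvection along this root; it fixes the sign of every simple root and is therefore trivial.\<close>

lemma coroot_unique_simple:
  assumes u: "u \<in> W" and i: "i \<in> I" and j: "j \<in> I" and eq: "act u (rt i) = rt j"
  shows "u (crt i) = crt j"
proof -
  define \<delta> where "\<delta> = u (crt i) - crt j"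
  define g where "g = u \<circ> srefl i \<circ> inv u \<circ> srefl j"
  have gW: "g \<in> W" unfolding g_def using u i j by (intro W_comp W_inv W_srefl)
  have pr_u: "pr (rt i) (inv u \<mu>) = pr (rt j) \<mu>" for \<mu>
    using pr_act[OF u, of "rt i" \<mu>] eq by simp
  have "pr (rt j) (u (crt i)) = 2"
    using pr_u[of "u (crt i)"] u i by (simp add: pr_rt_crt cartan_diag)
  then have \<delta>0: "pr (rt j) \<delta> = 0"
    using j by (simp add: \<delta>_def pr_simps pr_rt_crt cartan_diag)
  have g: "g \<mu> = \<mu> + zsmul (pr (rt j) \<mu>) \<delta>" for \<mu>
  proof -
    have eq: "g \<mu> = srefl j \<mu> - zsmul (pr (rt j) (srefl j \<mu>)) (u (crt i))"
      using u i by (simp add: g_def simple_reflection_def[of D i] W_diff W_zsmul pr_u)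
    show ?thesis using j unfolding eq
      by (intro coweight_eqI)
        (simp add: simple_reflection_def \<delta>_def pr_simps pr_rt_crt cartan_diag algebra_simps)
  qed
  have act_g: "act g \<theta> = \<theta> - zsmul (pr \<theta> \<delta>) (rt j)" for \<theta>
    by (rule act_unique[OF gW]) (simp add: g pr_simps \<delta>0)
  have "g = id"
  proof (rule id_if_no_descent[OF gW])
    fix k assume k: "k \<in> I"
    show "act g (rt k) \<in> pos"
    proof (cases "k = j")
      case True
      then show ?thesis using k by (simp add: act_g \<delta>0 zsmul_0 rt_pos)
    next
      case False
      let ?c = "\<lambda>l. (if l = k then 1 else 0) - (if l = j then pr (rt k) \<delta> else 0)"
      have "act g (rt k) = (\<Sum>l\<in>I. zsmul (?c l) (rt l))"
        unfolding zsmul_diff_left sum_subtractf using k j by (simp add: sum_single act_g)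
      then show ?thesis
        by (rule root_coeff_pos[OF rootI[OF gW k] _ k]) (use False in simp)
    qed
  qed
  \<comment> \<open>Evaluating the transvection at \<open>crt j\<close> shows that \<delta> is
    killed by 2; perfectness of the pairing excludes torsion.\<close>
  then have "zsmul 2 \<delta> = 0" using g[of "crt j"] j by (simp add: pr_rt_crt cartan_diag)
  then have "pr \<theta> (zsmul 2 \<delta>) = 0" for \<theta> by (simp only: pr_zero_right)
  then have "\<delta> = 0" by (intro coweight_eqI) (simp add: pr_simps)
  then show ?thesis by (simp add: \<delta>_def)
qed

text \<open>Two presentations of the same root differ by an element carrying one simple root to
  another, which therefore carries the simple coroots along.\<close>

lemma coroot_act_rt:
  assumes "w \<in> W" "i \<in> I"
  shows "coroot D (act w (rt i)) = w (crt i)"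
  unfolding coroot_def
proof (rule the_equality)
  fix \<gamma> assume "\<exists>w'\<in>W. \<exists>j\<in>I. act w (rt i) = act w' (rt j) \<and> \<gamma> = w' (crt j)"
  then obtain w' j where w': "w' \<in> W" "j \<in> I" "act w (rt i) = act w' (rt j)" "\<gamma> = w' (crt j)"
    by blast
  have "act (inv w' \<circ> w) (rt i) = rt j"
    using w' assms by (subst act_comp) simp_all
  then have "(inv w' \<circ> w) (crt i) = crt j"
    using w' assms by (intro coroot_unique_simple W_comp W_inv)
  then show "\<gamma> = w (crt i)" using w' by (metis comp_apply W_inv_apply(2))
qed (use assms in blast)

lemma coroot_act: "w \<in> W \<Longrightarrow> \<beta> \<in> roots D \<Longrightarrow> coroot D (act w \<beta>) = w (coroot D \<beta>)"
  by (erule rootE) (simp add: coroot_act_rt W_comp flip: act_comp del: comp_apply, simp)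

lemma coroot_rt: "i \<in> I \<Longrightarrow> coroot D (rt i) = crt i"
  using coroot_act_rt[of id i] by simp

lemma pr_coroot: "\<beta> \<in> roots D \<Longrightarrow> pr \<beta> (coroot D \<beta>) = 2"
  by (erule rootE) (simp add: coroot_act_rt pr_act pr_rt_crt cartan_diag)

lemma coroot_pos:
  assumes "\<beta> \<in> pos"
  shows "nonneg_comb crt (coroot D \<beta>)"
proof -
  obtain w i where w: "w \<in> W" "i \<in> I" "\<beta> = act w (rt i)" using assms rootE pos_root by blast
  then have "len w \<le> len (w \<circ> srefl i)" using act_rt_pos_iff(1) assms by simp
  then show ?thesis using simple_root_image_nonneg w by (simp add: coroot_act_rt)
qed

abbreviation rfl :: "'p \<Rightarrow> 'q \<Rightarrow> 'q" where "rfl \<equiv> reflection D"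

lemma refl_act:
  assumes "w \<in> W" "\<beta> \<in> roots D"
  shows "rfl (act w \<beta>) = w \<circ> rfl \<beta> \<circ> inv w"
  by (rule ext) (use assms in \<open>simp add: reflection_def coroot_act pr_act W_diff W_zsmul\<close>)

lemma refl_rt: "i \<in> I \<Longrightarrow> rfl (rt i) = srefl i"
  by (rule ext) (simp add: reflection_def simple_reflection_def coroot_rt)

lemma refl_act_rt: "w \<in> W \<Longrightarrow> i \<in> I \<Longrightarrow> rfl (act w (rt i)) = w \<circ> srefl i \<circ> inv w"
  using refl_act[of w "rt i"] rt_pos[of i] pos_root by (simp add: refl_rt)

lemma refl_W [simp]: "\<beta> \<in> roots D \<Longrightarrow> rfl \<beta> \<in> W"
  by (metis rootE refl_act_rt W_comp W_inv W_srefl)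

lemma refl_refl: "\<beta> \<in> roots D \<Longrightarrow> rfl \<beta> \<circ> rfl \<beta> = id"
  by (rule ext, rule coweight_eqI) (simp add: reflection_def pr_simps pr_coroot algebra_simps)

lemma comp_refl_cancel: "\<beta> \<in> roots D \<Longrightarrow> w \<circ> rfl \<beta> \<circ> rfl \<beta> = w"
  by (simp only: comp_assoc refl_refl comp_id)

lemma inv_refl: "\<beta> \<in> roots D \<Longrightarrow> inv (rfl \<beta>) = rfl \<beta>"
  by (rule inv_unique_comp) (rule refl_refl, assumption)+

lemma act_refl: "\<beta> \<in> roots D \<Longrightarrow> act (rfl \<beta>) \<theta> = \<theta> - zsmul (pr \<theta> (coroot D \<beta>)) \<beta>"
  by (rule weight_eqI) (simp add: pr_act inv_refl reflection_def pr_simps algebra_simps)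

lemma act_refl_self: "\<beta> \<in> roots D \<Longrightarrow> act (rfl \<beta>) \<beta> = - \<beta>"
  by (rule weight_eqI) (simp add: act_refl pr_coroot pr_simps)

text \<open>The reflection changes only the coefficient at \<open>i\<close>, so a positive
  coefficient elsewhere keeps the root positive. Otherwise the root is a multiple of
  \<open>rt i\<close>, and the multiple has to be 1.\<close>

lemma srefl_pos:
  assumes "\<beta> \<in> pos" "i \<in> I" "\<beta> \<noteq> rt i"
  shows "act (srefl i) \<beta> \<in> pos"
proof -
  obtain n :: "'i \<Rightarrow> nat" where n: "\<beta> = (\<Sum>j\<in>I. zsmul (int (n j)) (rt j))"
    using assms(1) by (auto simp: pos_roots_alt nonneg_comb_def)
  show ?thesis
  proof (cases "\<exists>j\<in>I. j \<noteq> i \<and> n j > 0")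
    case True
    then obtain j where j: "j \<in> I" "j \<noteq> i" "n j > 0" by blast
    let ?c = "\<lambda>l. int (n l) - (if l = i then pr \<beta> (crt i) else 0)"
    have "act (srefl i) \<beta> = (\<Sum>l\<in>I. zsmul (?c l) (rt l))"
      unfolding zsmul_diff_left sum_subtractf using assms(2) n by (simp add: sum_single act_srefl)
    then show ?thesis
      by (rule root_coeff_pos[OF act_root[OF W_srefl[OF assms(2)] pos_root[OF assms(1)]] _ j(1)])
        (use j in simp)
  next
    case False
    have "\<beta> = (\<Sum>j\<in>I. zsmul (if j = i then int (n i) else 0) (rt j))"
      unfolding n by (rule sum.cong) (use False in auto)
    then have \<beta>: "\<beta> = zsmul (int (n i)) (rt i)" using assms(2) by (simp add: sum_single)
    obtain w k where w: "w \<in> W" "k \<in> I" "\<beta> = act w (rt k)" using assms(1) rootE pos_root by blast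
    have rk: "rt k = zsmul (int (n i)) (act (inv w) (rt i))"
      using w \<beta> by (metis act_inv_act(1) act_zsmul W_inv)
    obtain c :: "'i \<Rightarrow> int" where c: "act (inv w) (rt i) = (\<Sum>l\<in>I. zsmul (c l) (rt l))"
    proof (cases "act (inv w) (rt i) \<in> pos")
      case True
      then show thesis using that by (auto simp: pos_roots_alt nonneg_comb_def)
    next
      case False
      then obtain m :: "'i \<Rightarrow> nat" where "- act (inv w) (rt i) = (\<Sum>l\<in>I. zsmul (int (m l)) (rt l))"
        using neg_pos_iff[OF rootI[OF W_inv[OF w(1)] assms(2)]]
        by (auto simp: pos_roots_alt nonneg_comb_def)
      then have "act (inv w) (rt i) = (\<Sum>l\<in>I. zsmul (- int (m l)) (rt l))"
        by (simp add: zsmul_minus_left sum_negf minus_equation_iff[of "act (inv w) (rt i)"])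
      then show thesis by (rule that)
    qed
    \<comment> \<open>The simple root \<open>rt k\<close> is \<open>n i\<close> times an integral
      combination of simple roots; comparing its coefficient 1 shows that \<open>n i\<close> divides
      1.\<close>
    have "(\<Sum>l\<in>I. zsmul (if l = k then 1 else 0) (rt l)) = (\<Sum>l\<in>I. zsmul (int (n i) * c l) (rt l))"
      using w(2) rk by (simp add: sum_single c zsmul_sum zsmul_mult)
    from rt_coeffs_eq[OF this w(2)] have "int (n i) * c k = 1" by simp
    then have "n i = 1" by (simp add: zmult_eq_1_iff)
    then show ?thesis using \<beta> assms(3) by simp
  qed
qed


section \<open>Inversions\<close>

text \<open>Removing right descents leads down to \<open>id\<close>; read backwards each step is an
  ascent, stated by the sign of a root because that is how inversion sets grow.\<close>

lemma W_ascent_induct [consumes 1, case_names id ascent]: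
  assumes "w \<in> W" "P id"
    and "\<And>w i. w \<in> W \<Longrightarrow> i \<in> I \<Longrightarrow> act w (rt i) \<in> pos \<Longrightarrow> P w \<Longrightarrow> P (w \<circ> srefl i)"
  shows "P w"
  using assms(1)
proof (induction "len w" arbitrary: w rule: less_induct)
  case less
  show ?case
  proof (cases "w = id")
    case False
    obtain i where i: "i \<in> I" "Suc (len (w \<circ> srefl i)) = len w"
      using right_descent_exists[OF less.prems False] .
    let ?v = "w \<circ> srefl i"
    have v: "?v \<in> W" using less.prems i by simp
    have "P ?v" by (rule less.hyps[OF _ v]) (use i in linarith)
    moreover have "act ?v (rt i) \<in> pos"
      using act_rt_pos_iff(1)[OF v i(1)] i by (simp only: comp_srefl_cancel)
    ultimately show ?thesis using assms(3)[OF v i(1)] i(1) by (simp only: comp_srefl_cancel)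
  qed (simp add: assms(2))
qed

lemma inversion_iff: "w \<in> W \<Longrightarrow> \<beta> \<in> inversions D w \<longleftrightarrow> \<beta> \<in> pos \<and> act w \<beta> \<notin> pos"
  unfolding inversions_def using neg_pos_iff act_root pos_root by auto

lemma inversions_id [simp]: "inversions D id = {}"
  by (auto simp: inversion_iff)

lemma act_inj: "w \<in> W \<Longrightarrow> inj_on (act w) A"
  by (metis inj_onI act_inv_act(1))

lemma inversions_ascent:
  assumes w: "w \<in> W" and i: "i \<in> I" and pos: "act w (rt i) \<in> pos"
  shows "inversions D (w \<circ> srefl i) = insert (rt i) (act (srefl i) ` inversions D w)"
    and "rt i \<notin> act (srefl i) ` inversions D w"
proof -
  have iff: "\<beta> \<in> inversions D (w \<circ> srefl i) \<longleftrightarrow> \<beta> \<in> pos \<and> act w (act (srefl i) \<beta>) \<notin> pos" for \<beta>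
    using inversion_iff[of "w \<circ> srefl i"] w i by (simp add: act_comp del: comp_apply)
  have ne: "\<beta> \<noteq> rt i" if "\<beta> \<in> inversions D w" for \<beta>
    using that pos w by (auto simp: inversion_iff)
  show "rt i \<notin> act (srefl i) ` inversions D w"
  proof
    assume "rt i \<in> act (srefl i) ` inversions D w"
    then obtain \<beta> where \<beta>: "\<beta> \<in> inversions D w" "rt i = act (srefl i) \<beta>" by blast
    then have "\<beta> = - rt i" using i by (metis act_srefl_srefl act_srefl_rt)
    then show False using \<beta>(1) w i pos_not_neg rt_pos by (simp add: inversion_iff)
  qed
  show "inversions D (w \<circ> srefl i) = insert (rt i) (act (srefl i) ` inversions D w)"
  proof (intro set_eqI iffI)
    fix \<beta> assume \<beta>: "\<beta> \<in> inversions D (w \<circ> srefl i)"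
    show "\<beta> \<in> insert (rt i) (act (srefl i) ` inversions D w)"
    proof (cases "\<beta> = rt i")
      case False
      then have "act (srefl i) \<beta> \<in> inversions D w"
        using \<beta> iff w i srefl_pos by (simp add: inversion_iff)
      then show ?thesis using i by (intro insertI2 image_eqI[of _ _ "act (srefl i) \<beta>"]) simp_all
    qed simp
  next
    fix \<beta> assume \<beta>: "\<beta> \<in> insert (rt i) (act (srefl i) ` inversions D w)"
    show "\<beta> \<in> inversions D (w \<circ> srefl i)"
    proof (cases "\<beta> = rt i")
      case True
      then show ?thesis using iff i w pos pos_not_neg by (simp add: rt_pos act_srefl_rt act_minus)
    next
      case False
      then obtain \<gamma> where "\<gamma> \<in> inversions D w" "\<beta> = act (srefl i) \<gamma>" using \<beta> by blast
      then show ?thesis unfolding iff using i w ne[of \<gamma>] srefl_pos by (simp add: inversion_iff)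
    qed
  qed
qed

lemma inversions_finite_card:
  assumes "w \<in> W"
  shows "finite (inversions D w) \<and> card (inversions D w) = len w"
  using assms
proof (induction rule: W_ascent_induct)
  case id show ?case by (simp del: id_apply)
next
  case (ascent w i)
  have "card (act (srefl i) ` inversions D w) = len w"
    using ascent by (simp add: card_image act_inj)
  then show ?case
    using ascent inversions_ascent[OF ascent(1-3)] act_rt_pos_iff(1)[OF ascent(1,2)]
    by (simp del: comp_apply)
qed

lemma finite_inversions: "w \<in> W \<Longrightarrow> finite (inversions D w)"
  and card_inversions: "w \<in> W \<Longrightarrow> card (inversions D w) = len w"
  using inversions_finite_card by auto

text \<open>Were the pairing nonpositive, the reflection would add a nonnegative multiple of \<beta>
  to \<gamma> and so keep it positive.\<close>

lemma inversions_refl: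
  assumes \<beta>: "\<beta> \<in> pos" and \<gamma>: "\<gamma> \<in> inversions D (rfl \<beta>)"
  shows "0 < pr \<gamma> (coroot D \<beta>)"
proof (rule ccontr)
  assume "\<not> 0 < pr \<gamma> (coroot D \<beta>)"
  then have *: "nonneg_comb rt (zsmul (- pr \<gamma> (coroot D \<beta>)) \<beta>)"
    using \<beta> by (intro nonneg_comb_zsmul) (auto simp: pos_roots_alt)
  have g: "\<gamma> \<in> pos" "act (rfl \<beta>) \<gamma> \<notin> pos"
    using \<gamma> \<beta> pos_root refl_W inversion_iff by auto
  have "nonneg_comb rt (act (rfl \<beta>) \<gamma>)"
    using nonneg_comb_add[OF _ *, of \<gamma>] g \<beta> pos_root
    by (simp add: act_refl zsmul_minus_left pos_roots_alt)
  then show False using g \<beta> pos_root by (auto simp: pos_roots_alt act_root)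
qed

text \<open>Strong exchange: walking up a reduced word of \<open>w\<close> from the right, the simple reflection that
  makes the image of \<open>\<beta>\<close> negative may be deleted.\<close>

lemma len_comp_refl_less:
  assumes "w \<in> W" "\<beta> \<in> pos" "act w \<beta> \<notin> pos"
  shows "len (w \<circ> rfl \<beta>) < len w"
  using assms
proof (induction w arbitrary: \<beta> rule: W_ascent_induct)
  case id
  then show ?case by (simp del: id_apply)
next
  case (ascent w i)
  have l: "len (w \<circ> srefl i) = Suc (len w)" using ascent act_rt_pos_iff(1) by blast
  show ?case
  proof (cases "\<beta> = rt i")
    case True
    then have "w \<circ> srefl i \<circ> rfl \<beta> = w" using ascent by (simp only: refl_rt comp_srefl_cancel)
    then show ?thesis using l by (simp only: lessI)
  next
    case False
    let ?\<gamma> = "act (srefl i) \<beta>"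
    have \<gamma>: "?\<gamma> \<in> pos" using srefl_pos False ascent by blast
    have "act w ?\<gamma> \<notin> pos" using ascent.prems(2) ascent.hyps by (simp add: act_comp del: comp_apply)
    then have less: "len (w \<circ> rfl ?\<gamma>) < len w" using ascent.IH \<gamma> by blast
    have "rfl ?\<gamma> = srefl i \<circ> rfl \<beta> \<circ> srefl i"
      using refl_act[of "srefl i" \<beta>] ascent pos_root by simp
    then have eq: "w \<circ> srefl i \<circ> rfl \<beta> = w \<circ> rfl ?\<gamma> \<circ> srefl i"
      using ascent by (simp add: fun_eq_iff srefl_srefl)
    have "len (w \<circ> rfl ?\<gamma> \<circ> srefl i) \<le> Suc (len (w \<circ> rfl ?\<gamma>))"
      using len_comp_srefl_le[of "w \<circ> rfl ?\<gamma>" i] ascent \<gamma> pos_root by (meson W_comp refl_W)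
    then show ?thesis using less l unfolding eq by linarith
  qed
qed

lemma len_comp_refl_greater:
  assumes "w \<in> W" "\<beta> \<in> pos" "act w \<beta> \<in> pos"
  shows "len w < len (w \<circ> rfl \<beta>)"
proof -
  have "act (w \<circ> rfl \<beta>) \<beta> = - act w \<beta>"
    using assms pos_root by (simp add: act_comp act_refl_self act_minus del: comp_apply)
  then have "len (w \<circ> rfl \<beta> \<circ> rfl \<beta>) < len (w \<circ> rfl \<beta>)"
    using len_comp_refl_less[of "w \<circ> rfl \<beta>" \<beta>] assms pos_root pos_not_neg by simp
  then show ?thesis using assms pos_root by (simp only: comp_refl_cancel)
qed

end

lemma sum_signs:
  assumes "finite A"
  shows "(\<Sum>x\<in>A. if P x then 1 else - 1 :: int) = int (card {x \<in> A. P x}) - int (card {x \<in> A. \<not> P x})"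
proof -
  have "A \<inter> {x. P x} = {x \<in> A. P x}" "A \<inter> - {x. P x} = {x \<in> A. \<not> P x}" by auto
  then show ?thesis using assms by (simp add: sum.If_cases)
qed

context kac_moody_root_datum
begin

section \<open>The Tits cone\<close>

lemma pr_act_apply [simp]: "w \<in> W \<Longrightarrow> pr (act w \<beta>) (w \<mu>) = pr \<beta> \<mu>"
  by (simp add: pr_act)

lemma dominant_pos: "\<kappa> \<in> dominant D \<Longrightarrow> \<beta> \<in> pos \<Longrightarrow> 0 \<le> pr \<beta> \<kappa>"
  by (auto simp: dominant_def pos_roots_alt nonneg_comb_def pr_sum_left pr_zsmul_left
      intro!: sum_nonneg)

text \<open>At an ascent the positive root \<open>act w (rt i)\<close> has a nonnegative value on
  the dominant image, but that value is \<open>- pr (rt i) \<kappa>\<close>. Hence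
  \<open>srefl i\<close> already fixes \<kappa>.\<close>

lemma dominant_fixed:
  assumes "w \<in> W" "\<kappa> \<in> dominant D" "w \<kappa> \<in> dominant D"
  shows "w \<kappa> = \<kappa>"
  using assms(1,3)
proof (induction rule: W_ascent_induct)
  case (ascent w i)
  have "pr (act w (rt i)) ((w \<circ> srefl i) \<kappa>) = - pr (rt i) \<kappa>"
    using ascent.hyps by (simp add: simple_reflection_def pr_simps pr_rt_crt cartan_diag)
  moreover have "0 \<le> pr (act w (rt i)) ((w \<circ> srefl i) \<kappa>)"
    using dominant_pos ascent by blast
  moreover have "0 \<le> pr (rt i) \<kappa>" using dominant_pos assms(2) rt_pos ascent by blast
  ultimately have "pr (rt i) \<kappa> = 0" by linarith
  then have "srefl i \<kappa> = \<kappa>" by (simp add: simple_reflection_def zsmul_0)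
  then show ?case using ascent by simp
qed simp

lemma dominant_conjugate_eq:
  assumes "v \<in> W" "\<kappa> \<in> dominant D"
  shows "dominant_conjugate D (v \<kappa>) = \<kappa>"
  unfolding dominant_conjugate_def
proof (rule the_equality)
  show "\<kappa> \<in> dominant D \<and> (\<exists>w\<in>W. \<kappa> = w (v \<kappa>))"
    using assms by (auto intro!: bexI[of _ "inv v"])
  fix \<nu> assume "\<nu> \<in> dominant D \<and> (\<exists>w\<in>W. \<nu> = w (v \<kappa>))"
  then obtain w where "w \<in> W" "\<nu> = (w \<circ> v) \<kappa>" "\<nu> \<in> dominant D" by auto
  then show "\<nu> = \<kappa>" using dominant_fixed[of "w \<circ> v"] assms by auto
qed

lemma tits_coneE:
  assumes "\<mu> \<in> tits_cone D"
  obtains v \<kappa> where "v \<in> W" "\<kappa> \<in> dominant D" "\<mu> = v \<kappa>"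
  using assms by (auto simp: tits_cone_def)

lemma tits_cone_W: "w \<in> W \<Longrightarrow> \<mu> \<in> tits_cone D \<Longrightarrow> w \<mu> \<in> tits_cone D"
proof (erule tits_coneE)
  fix v \<kappa> assume "w \<in> W" "v \<in> W" "\<kappa> \<in> dominant D" "\<mu> = v \<kappa>"
  then show ?thesis unfolding tits_cone_def by (intro UN_I[of "w \<circ> v"]) simp_all
qed

lemma neg_roots_dominant_conjugate:
  assumes "v \<in> W" "\<kappa> \<in> dominant D"
  shows "{\<beta> \<in> pos. pr \<beta> (v \<kappa>) < 0} \<subseteq> inversions D (inv v)"
proof
  fix \<beta> assume \<beta>: "\<beta> \<in> {\<beta> \<in> pos. pr \<beta> (v \<kappa>) < 0}"
  then have "pr (act (inv v) \<beta>) \<kappa> < 0" using assms by (simp add: pr_act)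
  then show "\<beta> \<in> inversions D (inv v)"
    using \<beta> assms dominant_pos[OF assms(2)] by (force simp: inversion_iff)
qed

text \<open>Reflecting in a simple root of negative value permutes the other positive roots and
  removes this one from the set, so finitely many reflections reach a dominant coweight.\<close>

lemma tits_coneI_finite:
  assumes "finite {\<beta> \<in> pos. pr \<beta> \<mu> < 0}"
  shows "\<mu> \<in> tits_cone D"
  using assms
proof (induction "card {\<beta> \<in> pos. pr \<beta> \<mu> < 0}" arbitrary: \<mu> rule: less_induct)
  case less
  let ?N = "\<lambda>\<mu>. {\<beta> \<in> pos. pr \<beta> \<mu> < 0}"
  show ?case
  proof (cases "\<mu> \<in> dominant D")
    case True
    then show ?thesis unfolding tits_cone_def by (intro UN_I[of id]) simp_all
  next
    case False
    then obtain i where i: "i \<in> I" "pr (rt i) \<mu> < 0" by (auto simp: dominant_def not_le)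
    have pr_s: "pr \<beta> (srefl i \<mu>) = pr (act (srefl i) \<beta>) \<mu>" for \<beta>
      using i by (simp add: pr_act)
    have sub: "act (srefl i) ` ?N (srefl i \<mu>) \<subseteq> ?N \<mu> - {rt i}"
    proof
      fix \<gamma> assume "\<gamma> \<in> act (srefl i) ` ?N (srefl i \<mu>)"
      then obtain \<beta> where \<beta>: "\<beta> \<in> pos" "pr (act (srefl i) \<beta>) \<mu> < 0" "\<gamma> = act (srefl i) \<beta>"
        by (auto simp: pr_s)
      have "\<beta> \<noteq> rt i" using \<beta> i by (auto simp: act_srefl_rt pr_simps)
      then have "\<gamma> \<in> pos" using \<beta> i srefl_pos by simp
      moreover have "\<gamma> \<noteq> rt i"
        using \<beta> i pos_not_neg rt_pos by (metis act_srefl_rt act_srefl_srefl)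
      ultimately show "\<gamma> \<in> ?N \<mu> - {rt i}" using \<beta> by simp
    qed
    have inj: "inj_on (act (srefl i)) A" for A using act_inj i by simp
    have fin: "finite (?N (srefl i \<mu>))"
      using finite_subset[OF sub] less.prems finite_imageD[OF _ inj] by blast
    have "card (?N (srefl i \<mu>)) \<le> card (?N \<mu> - {rt i})"
      using card_mono[OF _ sub] less.prems by (simp add: card_image[OF inj])
    also have "\<dots> < card (?N \<mu>)"
      using i less.prems rt_pos by (intro psubset_card_mono) auto
    finally have "srefl i \<mu> \<in> tits_cone D" using less.hyps fin by blast
    then show ?thesis using tits_cone_W[of "srefl i" "srefl i \<mu>"] i by (simp add: srefl_srefl)
  qed
qed

lemma tits_cone_finite:
  assumes "\<mu> \<in> tits_cone D"
  shows "finite {\<beta> \<in> pos. pr \<beta> \<mu> < 0}"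
proof -
  obtain v \<kappa> where "v \<in> W" "\<kappa> \<in> dominant D" "\<mu> = v \<kappa>" using assms by (rule tits_coneE)
  then show ?thesis
    using finite_subset[OF neg_roots_dominant_conjugate] finite_inversions by simp
qed

text \<open>Finiteness of the set of negative values passes to sums, whereas two coweights need not
  be made dominant by the same Weyl group element.\<close>

lemma tits_cone_add:
  assumes "\<mu> \<in> tits_cone D" "\<nu> \<in> tits_cone D"
  shows "\<mu> + \<nu> \<in> tits_cone D"
proof (rule tits_coneI_finite, rule finite_subset)
  show "{\<beta> \<in> pos. pr \<beta> (\<mu> + \<nu>) < 0} \<subseteq> {\<beta> \<in> pos. pr \<beta> \<mu> < 0} \<union> {\<beta> \<in> pos. pr \<beta> \<nu> < 0}"
    by (auto simp: pr_simps)
qed (use assms tits_cone_finite in blast)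

lemma affine_mult_closed:
  assumes "x \<in> affine_weyl_semigroup D" "y \<in> affine_weyl_semigroup D"
  shows "affine_mult x y \<in> affine_weyl_semigroup D"
proof -
  have "fst x \<in> W" "snd x \<in> tits_cone D" "fst y \<in> W" "snd y \<in> tits_cone D"
    using assms by (auto simp: affine_weyl_semigroup_def)
  then have "fst x \<circ> fst y \<in> W" "inv (fst y) (snd x) + snd y \<in> tits_cone D"
    by (auto intro: tits_cone_add tits_cone_W[OF W_inv])
  then show ?thesis unfolding affine_weyl_semigroup_def affine_mult_def by (rule SigmaI)
qed


section \<open>Length positivity\<close>

lemma root_length_minus:
  assumes "fst x \<in> W" "\<beta> \<in> roots D"
  shows "root_length D x (- \<beta>) = - root_length D x \<beta>"
proof -
  have "of_bool (- \<gamma> \<in> pos) = 1 - (of_bool (\<gamma> \<in> pos) :: int)" if "\<gamma> \<in> roots D" for \<gamma>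
    using neg_pos_iff[OF that] by simp
  note this[OF assms(2)] this[OF act_root[OF assms]]
  then show ?thesis
    unfolding root_length_def act_minus[OF assms(1)] pr_minus_left by linarith
qed

lemma length_positive_W: "v \<in> length_positive D x \<Longrightarrow> v \<in> W"
  by (simp add: length_positive_def)

lemma length_positiveD: "v \<in> length_positive D x \<Longrightarrow> \<beta> \<in> pos \<Longrightarrow> 0 \<le> root_length D x (act v \<beta>)"
  by (simp add: length_positive_def)

text \<open>Indexing by \<gamma> = \<open>\<plusminus>v\<beta>\<close> instead of \<beta> lets one
  positive root carry one condition, which can be matched with its share of the length.\<close>

lemma length_positive_iff:
  assumes "v \<in> W"
  shows "v \<in> length_positive D x \<longleftrightarrow>
    (\<forall>\<gamma>\<in>pos. 0 \<le> root_length D x (if act (inv v) \<gamma> \<in> pos then \<gamma> else - \<gamma>))"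
proof (intro iffI ballI)
  fix \<gamma> assume v: "v \<in> length_positive D x" and \<gamma>: "\<gamma> \<in> pos"
  show "0 \<le> root_length D x (if act (inv v) \<gamma> \<in> pos then \<gamma> else - \<gamma>)"
    using length_positiveD[OF v, of "act (inv v) \<gamma>"] length_positiveD[OF v, of "- act (inv v) \<gamma>"]
      assms neg_pos_iff[of "act (inv v) \<gamma>"] \<gamma> pos_root act_root
    by (auto simp: act_minus)
next
  assume *: "\<forall>\<gamma>\<in>pos. 0 \<le> root_length D x (if act (inv v) \<gamma> \<in> pos then \<gamma> else - \<gamma>)"
  have "0 \<le> root_length D x (act v \<beta>)" if \<beta>: "\<beta> \<in> pos" for \<beta>
    using *[rule_format, of "act v \<beta>"] *[rule_format, of "- act v \<beta>"] \<beta> assms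
      pos_or_neg[OF act_root[OF assms pos_root[OF \<beta>]]] pos_not_neg[OF \<beta>]
    by (auto simp: act_minus)
  then show "v \<in> length_positive D x" using assms by (simp add: length_positive_def)
qed

text \<open>An element of minimal length among the \<open>v\<close> with \<open>v \<kappa> = \<mu>\<close>, for \<open>\<kappa>\<close> dominant, is length positive.\<close>

lemma length_positive_nonempty:
  assumes "x \<in> affine_weyl_semigroup D"
  shows "length_positive D x \<noteq> {}"
proof -
  obtain w \<mu> where x: "x = (w, \<mu>)" "w \<in> W" "\<mu> \<in> tits_cone D"
    using assms by (auto simp: affine_weyl_semigroup_def)
  obtain v0 \<kappa> where v0: "v0 \<in> W" "\<kappa> \<in> dominant D" "\<mu> = v0 \<kappa>" using x(3) by (rule tits_coneE)
  obtain v where v: "v \<in> W" "v \<kappa> = \<mu>"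
    and least: "\<And>v'. v' \<in> W \<Longrightarrow> v' \<kappa> = \<mu> \<Longrightarrow> len v \<le> len v'"
    using ex_has_least_nat[of "\<lambda>v. v \<in> W \<and> v \<kappa> = \<mu>" v0 len] v0 by blast
  have pr_inv: "pr \<gamma> \<mu> = pr (act (inv v) \<gamma>) \<kappa>" for \<gamma> using v by (simp add: pr_act)
  have "v \<in> length_positive D x"
    unfolding length_positive_iff[OF v(1)]
  proof
    fix \<gamma> assume \<gamma>: "\<gamma> \<in> pos"
    show "0 \<le> root_length D x (if act (inv v) \<gamma> \<in> pos then \<gamma> else - \<gamma>)"
    proof (cases "act (inv v) \<gamma> \<in> pos")
      case True
      then show ?thesis using dominant_pos[OF v0(2) True] \<gamma>
        by (simp add: root_length_def x pr_inv)
    next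
      case False
      then have "- act (inv v) \<gamma> \<in> pos" using neg_pos_iff \<gamma> v act_root pos_root by simp
      from dominant_pos[OF v0(2) this] have "pr \<gamma> \<mu> \<le> 0" by (simp add: pr_inv pr_simps)
      moreover have "pr \<gamma> \<mu> \<noteq> 0"
      proof
        \<comment> \<open>The reflection in \<gamma> then fixes \<mu>, and composing with it
          shortens \<open>v\<close>.\<close>
        assume "pr \<gamma> \<mu> = 0"
        then have "(rfl \<gamma> \<circ> v) \<kappa> = \<mu>" using v by (simp add: reflection_def zsmul_0)
        moreover have "rfl \<gamma> \<circ> v \<in> W" using \<gamma> v pos_root by simp
        moreover have "len (rfl \<gamma> \<circ> v) < len v"
        proof -
          have "len (inv v \<circ> rfl \<gamma>) < len (inv v)"
            using len_comp_refl_less[OF W_inv[OF v(1)] \<gamma> False] .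
          moreover have "inv v \<circ> rfl \<gamma> = inv (rfl \<gamma> \<circ> v)"
            using v \<gamma> pos_root by (simp only: W_inv_comp refl_W inv_refl)
          ultimately show ?thesis using v \<gamma> pos_root by (simp only: len_inv W_comp refl_W)
        qed
        ultimately show False using least[of "rfl \<gamma> \<circ> v"] by (meson not_le)
      qed
      \<comment> \<open>At the negative root the functional is \<open>- pr \<gamma> \<mu>\<close>
        minus at most 1, so the strict inequality is just enough.\<close>
      ultimately have "pr \<gamma> \<mu> \<le> - 1" by linarith
      then show ?thesis using False \<gamma> pos_not_neg[OF \<gamma>] by (simp add: root_length_def x pr_simps)
    qed
  qed
  then show ?thesis by blast
qed

text \<open>The reflection permutes the positive roots other than \<open>rt i\<close>, and at
  \<open>rt i\<close> the functional changes its sign, which is harmless for the value 0.\<close>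

lemma length_positive_srefl:
  assumes "x \<in> affine_weyl_semigroup D" "u \<in> length_positive D x" "i \<in> I"
    and zero: "root_length D x (act u (rt i)) = 0"
  shows "u \<circ> srefl i \<in> length_positive D x"
proof -
  have u: "u \<in> W" using assms(2) length_positive_W by blast
  have x: "fst x \<in> W" using assms(1) by (auto simp: affine_weyl_semigroup_def)
  have "0 \<le> root_length D x (act (u \<circ> srefl i) \<beta>)" if \<beta>: "\<beta> \<in> pos" for \<beta>
  proof (cases "\<beta> = rt i")
    case True
    then show ?thesis using zero root_length_minus[OF x rootI[OF u assms(3)]] u assms(3)
      by (simp only: act_comp_srefl_rt)
  next
    case False
    then show ?thesis using length_positiveD[OF assms(2) srefl_pos[OF \<beta> assms(3) False]] u assms(3)
      by (simp only: act_comp W_srefl)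
  qed
  then show ?thesis using u assms(3) unfolding length_positive_def by (auto simp del: comp_apply)
qed

text \<open>The set \<open>?C\<close> of roots inverted by both \<open>v\<close> and
  \<open>w \<circ> v\<close> cancels from the two lengths. What is left corresponds to the
  inversions of \<open>w\<close>, divided into \<open>?A\<close> and \<open>?B\<close> by their sign
  under \<open>inv v\<close>.\<close>

lemma len_comp_inversions:
  assumes w: "w \<in> W" and v: "v \<in> W"
  shows "int (len (w \<circ> v)) - int (len v) =
    (\<Sum>\<gamma>\<in>inversions D w. if act (inv v) \<gamma> \<in> pos then 1 else - 1)"
proof -
  let ?A = "{\<gamma> \<in> inversions D w. act (inv v) \<gamma> \<in> pos}"
  let ?B = "{\<gamma> \<in> inversions D w. act (inv v) \<gamma> \<notin> pos}"
  let ?C = "{\<beta> \<in> inversions D v. act w (act v \<beta>) \<notin> pos}"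
  let ?f = "\<lambda>\<gamma>. - act (inv v) \<gamma>"
  have wv: "\<beta> \<in> inversions D (w \<circ> v) \<longleftrightarrow> \<beta> \<in> pos \<and> act w (act v \<beta>) \<notin> pos" for \<beta>
    using inversion_iff[of "w \<circ> v"] w v by (simp add: act_comp del: comp_apply)
  have inj_f: "inj_on ?f ?B"
    using act_inj[OF W_inv[OF v]] by (auto simp: inj_on_def)
  have neg: "- act (inv v) \<gamma> \<in> pos \<longleftrightarrow> act (inv v) \<gamma> \<notin> pos" if "\<gamma> \<in> pos" for \<gamma>
    using that neg_pos_iff act_root pos_root v by simp
  have "inversions D (w \<circ> v) = act (inv v) ` ?A \<union> ?C"
  proof (intro set_eqI iffI)
    fix \<beta> assume "\<beta> \<in> inversions D (w \<circ> v)"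
    then have \<beta>: "\<beta> \<in> pos" "act w (act v \<beta>) \<notin> pos" unfolding wv by auto
    show "\<beta> \<in> act (inv v) ` ?A \<union> ?C"
    proof (cases "act v \<beta> \<in> pos")
      case True
      then have "act v \<beta> \<in> ?A" using \<beta> w v by (simp add: inversion_iff)
      then show ?thesis using v by (intro UnI1 image_eqI[of _ _ "act v \<beta>"]) simp_all
    qed (use \<beta> v in \<open>simp add: inversion_iff\<close>)
  qed (use w v in \<open>auto simp: wv inversion_iff\<close>)
  moreover have "act (inv v) ` ?A \<inter> ?C = {}" using w v by (auto simp: inversion_iff)
  ultimately have 1: "len (w \<circ> v) = card ?A + card ?C"
    using w v by (simp add: card_Un_disjoint finite_inversions card_image act_inj flip: card_inversions
        del: comp_apply)
  have "inversions D v = ?C \<union> ?f ` ?B"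
  proof (intro set_eqI iffI)
    fix \<beta> assume \<beta>: "\<beta> \<in> inversions D v"
    show "\<beta> \<in> ?C \<union> ?f ` ?B"
    proof (cases "act w (act v \<beta>) \<in> pos")
      case True
      have "\<beta> \<in> pos" "act v \<beta> \<notin> pos" using \<beta> v by (auto simp: inversion_iff)
      then have "- act v \<beta> \<in> ?B"
        using True pos_not_neg neg_pos_iff act_root pos_root w v
        by (simp add: inversion_iff act_minus)
      then show ?thesis using v by (intro UnI2 image_eqI[of _ _ "- act v \<beta>"]) (simp_all add: act_minus)
    qed (use \<beta> in simp)
  next
    fix \<beta> assume "\<beta> \<in> ?C \<union> ?f ` ?B"
    then show "\<beta> \<in> inversions D v"
    proof
      assume "\<beta> \<in> ?f ` ?B"
      then obtain \<gamma> where "\<gamma> \<in> ?B" "\<beta> = - act (inv v) \<gamma>" by blast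
      then show ?thesis using w v neg[of \<gamma>] pos_not_neg[of \<gamma>] by (simp add: inversion_iff act_minus)
    qed simp
  qed
  moreover have "?C \<inter> ?f ` ?B = {}"
    using w v pos_not_neg neg_pos_iff act_root pos_root by (auto simp: inversion_iff act_minus)
  ultimately have "card (inversions D v) = card ?C + card (?f ` ?B)"
    using w v finite_inversions by (metis (no_types, lifting) card_Un_disjoint finite_Un)
  then have 2: "len v = card ?C + card ?B"
    using v by (simp only: card_inversions card_image[OF inj_f])
  have "inversions D w = ?A \<union> ?B" "?A \<inter> ?B = {}" by auto
  then have "(\<Sum>\<gamma>\<in>inversions D w. if act (inv v) \<gamma> \<in> pos then 1 else - 1 :: int) =
      int (card ?A) - int (card ?B)"
    using sum_signs[OF finite_inversions[OF w]] by simp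
  then show ?thesis using 1 2 by linarith
qed

section \<open>Length estimates by means of \<rho>\<close>

context
  fixes \<rho> :: "'q \<Rightarrow> real"
  assumes rho: "is_rho D \<rho>"
begin

lemma rho_additive: "additive \<rho>"
  using rho unfolding is_rho_def fundamental_weights_def
  by (auto simp: additive_def sum.distrib)

lemma rho_crt: "j \<in> I \<Longrightarrow> \<rho> (crt j) = 1"
  using rho finite_I unfolding is_rho_def fundamental_weights_def by auto

lemmas rho_add = additive.add[OF rho_additive]
  and rho_diff = additive.diff[OF rho_additive]
  and rho_minus = additive.minus[OF rho_additive]
  and rho_zsmul = additive_zsmul[OF rho_additive]

text \<open>This is the identity that \<rho> minus its image under the inverse of \<open>w\<close>
  is the sum of the inversions of \<open>w\<close>, evaluated at \<mu>; each ascent adds one simple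
  root.\<close>

lemma rho_inversions:
  assumes "w \<in> W"
  shows "\<rho> \<mu> - \<rho> (w \<mu>) = real_of_int (\<Sum>\<beta>\<in>inversions D w. pr \<beta> \<mu>)"
  using assms
proof (induction arbitrary: \<mu> rule: W_ascent_induct)
  case id
  show ?case by (simp add: inversions_id[unfolded id_def])
next
  case (ascent w i)
  note inv = inversions_ascent[OF ascent.hyps]
  have "(\<Sum>\<beta>\<in>act (srefl i) ` inversions D w. pr \<beta> \<mu>) = (\<Sum>\<beta>\<in>inversions D w. pr \<beta> (srefl i \<mu>))"
    using ascent.hyps by (simp add: sum.reindex act_inj pr_act)
  then have "(\<Sum>\<beta>\<in>inversions D (w \<circ> srefl i). pr \<beta> \<mu>) =
      pr (rt i) \<mu> + (\<Sum>\<beta>\<in>inversions D w. pr \<beta> (srefl i \<mu>))"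
    using inv finite_inversions[OF ascent.hyps(1)] by (simp del: comp_apply)
  moreover have "\<rho> \<mu> - \<rho> (srefl i \<mu>) = real_of_int (pr (rt i) \<mu>)"
    using ascent.hyps by (simp add: simple_reflection_def rho_diff rho_zsmul rho_crt)
  ultimately show ?case using ascent.IH[of "srefl i \<mu>"] unfolding comp_apply[of w] by linarith
qed

lemma two_rho_coroot:
  assumes "\<beta> \<in> pos"
  shows "2 * \<rho> (coroot D \<beta>) = real_of_int (\<Sum>\<gamma>\<in>inversions D (rfl \<beta>). pr \<gamma> (coroot D \<beta>))"
proof -
  have "rfl \<beta> (coroot D \<beta>) = - coroot D \<beta>"
    using assms pos_root by (intro coweight_eqI) (simp add: reflection_def pr_coroot pr_simps)
  then show ?thesis
    using rho_inversions[of "rfl \<beta>" "coroot D \<beta>"] assms pos_root by (simp add: rho_minus)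
qed

text \<open>In \<open>two_rho_coroot\<close> the summand of \<beta> is 2 and every other is at least
  1, so the sum exceeds the number of inversions by at least 1. Equality leaves no room for larger
  summands.\<close>

lemma len_refl_bound:
  assumes \<beta>: "\<beta> \<in> pos"
  shows "real (len (rfl \<beta>)) + 1 \<le> 2 * \<rho> (coroot D \<beta>)"
    and "2 * \<rho> (coroot D \<beta>) = real (len (rfl \<beta>)) + 1 \<Longrightarrow> \<gamma> \<in> inversions D (rfl \<beta>) \<Longrightarrow>
      \<gamma> \<noteq> \<beta> \<Longrightarrow> pr \<gamma> (coroot D \<beta>) = 1"
proof -
  let ?S = "inversions D (rfl \<beta>)" and ?c = "coroot D \<beta>"
  have W: "rfl \<beta> \<in> W" using \<beta> pos_root by simp
  have \<beta>S: "\<beta> \<in> ?S" using \<beta> W pos_not_neg by (simp add: inversion_iff act_refl_self pos_root)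
  have fin: "finite ?S" and card: "card ?S = len (rfl \<beta>)"
    using W finite_inversions card_inversions by auto
  have sum: "(\<Sum>\<gamma>\<in>?S. pr \<gamma> ?c) = 2 + (\<Sum>\<gamma>\<in>?S - {\<beta>}. pr \<gamma> ?c)"
    using sum.remove[OF fin \<beta>S, of "\<lambda>\<gamma>. pr \<gamma> ?c"] \<beta> by (simp add: pr_coroot pos_root)
  define T where "T = (\<Sum>\<gamma>\<in>?S - {\<beta>}. pr \<gamma> ?c - 1)"
  have "(\<Sum>\<gamma>\<in>?S - {\<beta>}. pr \<gamma> ?c) = T + int (card (?S - {\<beta>}))"
    by (simp add: T_def sum_subtractf)
  moreover have "int (card (?S - {\<beta>})) = int (len (rfl \<beta>)) - 1"
    using \<beta>S fin card card_gt_0_iff[of ?S] by (auto simp: card_Diff_singleton)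
  ultimately have eq: "2 * \<rho> ?c = real (len (rfl \<beta>)) + 1 + real_of_int T"
    using two_rho_coroot[OF \<beta>] sum by simp
  have ge: "0 \<le> pr \<gamma> ?c - 1" if "\<gamma> \<in> ?S - {\<beta>}" for \<gamma>
    using inversions_refl[OF \<beta>, of \<gamma>] that by simp
  have "0 \<le> T" unfolding T_def by (rule sum_nonneg) (rule ge)
  then show "real (len (rfl \<beta>)) + 1 \<le> 2 * \<rho> ?c" using eq by linarith
  assume *: "2 * \<rho> ?c = real (len (rfl \<beta>)) + 1" "\<gamma> \<in> ?S" "\<gamma> \<noteq> \<beta>"
  have "T = 0" using eq *(1) by linarith
  then have "\<forall>\<gamma>\<in>?S - {\<beta>}. pr \<gamma> ?c - 1 = 0"
    unfolding T_def by (subst (asm) sum_nonneg_eq_0_iff) (use ge fin in auto)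
  then show "pr \<gamma> ?c = 1" using *(2,3) by simp
qed

text \<open>The contribution of a positive root \<open>\<gamma>\<close> to the difference of the two sides of the length
  estimate below.\<close>

definition length_defect :: "'q affine \<Rightarrow> ('q \<Rightarrow> 'q) \<Rightarrow> 'p \<Rightarrow> int" where
  "length_defect x v \<gamma> = - 2 * min 0 (pr \<gamma> (snd x))
     + (if act (inv v) \<gamma> \<in> pos then 0 else 2 * pr \<gamma> (snd x))
     + (if act (fst x) \<gamma> \<in> pos then 0
        else (if 0 \<le> pr \<gamma> (snd x) then 1 else - 1) - (if act (inv v) \<gamma> \<in> pos then 1 else - 1))"

lemma length_defect_nonneg: "0 \<le> length_defect x v \<gamma>"
  by (auto simp: length_defect_def)

text \<open>In each of the four sign cases the defect is twice the negative part of the root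
  functional, taken at whichever of \<gamma> and -\<gamma> becomes positive under
  \<open>inv v\<close>.\<close>

lemma length_defect_eq_0_iff:
  assumes "fst x \<in> W" "\<gamma> \<in> pos"
  shows "length_defect x v \<gamma> = 0 \<longleftrightarrow>
    0 \<le> root_length D x (if act (inv v) \<gamma> \<in> pos then \<gamma> else - \<gamma>)"
  unfolding length_defect_def if_distrib[of "root_length D x"] root_length_minus[OF assms(1) pos_root[OF assms(2)]]
  using assms(2) by (auto simp: root_length_def min_def)

text \<open>Passing from \<mu> to its dominant conjugate gains exactly the negative values. The set
  \<open>S\<close> may be larger, so that this sum can share its index set with others.\<close>

lemma rho_dominant_conjugate:
  assumes "\<mu> \<in> tits_cone D" "finite S" "S \<subseteq> pos" "{\<beta> \<in> pos. pr \<beta> \<mu> < 0} \<subseteq> S"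
  shows "\<rho> (dominant_conjugate D \<mu>) = \<rho> \<mu> - real_of_int (\<Sum>\<gamma>\<in>S. min 0 (pr \<gamma> \<mu>))"
proof -
  let ?N = "{\<beta> \<in> pos. pr \<beta> \<mu> < 0}"
  obtain v \<kappa> where v: "v \<in> W" "\<kappa> \<in> dominant D" "\<mu> = v \<kappa>" using assms(1) by (rule tits_coneE)
  have "(\<Sum>\<gamma>\<in>inversions D (inv v). pr \<gamma> \<mu>) = (\<Sum>\<gamma>\<in>?N. pr \<gamma> \<mu>)"
  proof (rule sum.mono_neutral_right)
    show "?N \<subseteq> inversions D (inv v)" using neg_roots_dominant_conjugate v by simp
    show "\<forall>\<gamma>\<in>inversions D (inv v) - ?N. pr \<gamma> \<mu> = 0"
    proof
      fix \<gamma> assume \<gamma>: "\<gamma> \<in> inversions D (inv v) - ?N"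
      then have "\<gamma> \<in> pos" "- act (inv v) \<gamma> \<in> pos" by (auto simp: inversions_def)
      then have "0 \<le> pr (- act (inv v) \<gamma>) \<kappa>" "\<not> pr \<gamma> \<mu> < 0" using \<gamma> dominant_pos v by auto
      then show "pr \<gamma> \<mu> = 0" using v by (simp add: pr_simps pr_act)
    qed
  qed (use v finite_inversions in simp)
  also have "\<dots> = (\<Sum>\<gamma>\<in>?N. min 0 (pr \<gamma> \<mu>))" by (rule sum.cong) auto
  also have "\<dots> = (\<Sum>\<gamma>\<in>S. min 0 (pr \<gamma> \<mu>))"
    by (rule sum.mono_neutral_left) (use assms in auto)
  finally show ?thesis
    using rho_inversions[of "inv v" \<mu>] dominant_conjugate_eq[OF v(1,2)] v by simp
qed

text \<open>The ingredients are sums over different finite sets of positive roots; extended by zero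
  to the common finite set \<open>S\<close>, they can be compared root by root.\<close>

lemma affine_length_defect:
  assumes x: "x \<in> affine_weyl_semigroup D" and v: "v \<in> W"
  defines "S \<equiv> {\<beta> \<in> pos. pr \<beta> (snd x) < 0} \<union> inversions D (fst x) \<union> inversions D (inv v)"
  shows "affine_length D \<rho> x =
    2 * \<rho> (inv v (snd x)) - real (len v) + real (len (fst x \<circ> v))
    + real_of_int (\<Sum>\<gamma>\<in>S. length_defect x v \<gamma>)"
proof -
  obtain w \<mu> where x': "x = (w, \<mu>)" "w \<in> W" "\<mu> \<in> tits_cone D"
    using x by (auto simp: affine_weyl_semigroup_def)
  have fin: "finite S" unfolding S_def using x' v tits_cone_finite finite_inversions by simp
  have sub: "S \<subseteq> pos" unfolding S_def by (auto simp: inversions_def)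
  have invw: "inversions D w = {\<gamma> \<in> S. act w \<gamma> \<notin> pos}"
    using x' sub unfolding S_def by (auto simp: inversion_iff)
  have invv: "inversions D (inv v) = {\<gamma> \<in> S. act (inv v) \<gamma> \<notin> pos}"
    using v sub unfolding S_def by (auto simp: inversion_iff)
  have 1: "\<rho> (dominant_conjugate D \<mu>) = \<rho> \<mu> - real_of_int (\<Sum>\<gamma>\<in>S. min 0 (pr \<gamma> \<mu>))"
    by (rule rho_dominant_conjugate) (use x' fin sub S_def in auto)
  have 2: "\<rho> \<mu> - \<rho> (inv v \<mu>) = real_of_int (\<Sum>\<gamma>\<in>S. if act (inv v) \<gamma> \<in> pos then 0 else pr \<gamma> \<mu>)"
    unfolding rho_inversions[OF W_inv[OF v]] invv
    by (intro arg_cong[of _ _ real_of_int] sum.mono_neutral_cong_left) (use fin in auto)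
  have 3: "int (len (w \<circ> v)) - int (len v) =
      (\<Sum>\<gamma>\<in>S. if act w \<gamma> \<in> pos then 0 else if act (inv v) \<gamma> \<in> pos then 1 else - 1)"
    unfolding len_comp_inversions[OF x'(2) v] invw
    by (intro sum.mono_neutral_cong_left) (use fin in auto)
  have "(\<Sum>\<gamma>\<in>inversions D w. if 0 \<le> pr \<gamma> \<mu> then 1 else - 1 :: int) =
      int (card {\<gamma> \<in> inversions D w. 0 \<le> pr \<gamma> \<mu>}) - int (card {\<gamma> \<in> inversions D w. pr \<gamma> \<mu> < 0})"
    using sum_signs[OF finite_inversions[OF x'(2)], of "\<lambda>\<gamma>. 0 \<le> pr \<gamma> \<mu>"] by (simp add: not_le)
  moreover have "(\<Sum>\<gamma>\<in>inversions D w. if 0 \<le> pr \<gamma> \<mu> then 1 else - 1 :: int) =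
      (\<Sum>\<gamma>\<in>S. if act w \<gamma> \<in> pos then 0 else if 0 \<le> pr \<gamma> \<mu> then 1 else - 1)"
    unfolding invw by (intro sum.mono_neutral_cong_left) (use fin in auto)
  ultimately have 4: "affine_length D \<rho> x = 2 * \<rho> (dominant_conjugate D \<mu>) +
      real_of_int (\<Sum>\<gamma>\<in>S. if act w \<gamma> \<in> pos then 0 else if 0 \<le> pr \<gamma> \<mu> then 1 else - 1)"
    by (simp add: affine_length_def x')
  have "length_defect x v \<gamma> = - 2 * min 0 (pr \<gamma> \<mu>)
      + 2 * (if act (inv v) \<gamma> \<in> pos then 0 else pr \<gamma> \<mu>)
      + (if act w \<gamma> \<in> pos then 0 else if 0 \<le> pr \<gamma> \<mu> then 1 else - 1)
      - (if act w \<gamma> \<in> pos then 0 else if act (inv v) \<gamma> \<in> pos then 1 else - 1)" for \<gamma>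
    by (simp add: length_defect_def x')
  then have "(\<Sum>\<gamma>\<in>S. length_defect x v \<gamma>) = - 2 * (\<Sum>\<gamma>\<in>S. min 0 (pr \<gamma> \<mu>))
      + 2 * (\<Sum>\<gamma>\<in>S. if act (inv v) \<gamma> \<in> pos then 0 else pr \<gamma> \<mu>)
      + (\<Sum>\<gamma>\<in>S. if act w \<gamma> \<in> pos then 0 else if 0 \<le> pr \<gamma> \<mu> then 1 else - 1)
      - (\<Sum>\<gamma>\<in>S. if act w \<gamma> \<in> pos then 0 else if act (inv v) \<gamma> \<in> pos then 1 else - 1)"
    by (simp only: sum.distrib sum_subtractf sum_distrib_left)
  then show ?thesis using 1 2 3 4 unfolding x' fst_conv snd_conv by linarith
qed

theorem affine_length_ge:
  assumes x: "x \<in> affine_weyl_semigroup D" and v: "v \<in> W"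
  shows "2 * \<rho> (inv v (snd x)) - real (len v) + real (len (fst x \<circ> v)) \<le> affine_length D \<rho> x"
    and "affine_length D \<rho> x = 2 * \<rho> (inv v (snd x)) - real (len v) + real (len (fst x \<circ> v))
      \<longleftrightarrow> v \<in> length_positive D x"
proof -
  let ?S = "{\<beta> \<in> pos. pr \<beta> (snd x) < 0} \<union> inversions D (fst x) \<union> inversions D (inv v)"
  note eq = affine_length_defect[OF x v]
  have w: "fst x \<in> W" and \<mu>: "snd x \<in> tits_cone D"
    using x by (auto simp: affine_weyl_semigroup_def)
  have nn: "0 \<le> (\<Sum>\<gamma>\<in>?S. length_defect x v \<gamma>)" by (intro sum_nonneg length_defect_nonneg)
  then show "2 * \<rho> (inv v (snd x)) - real (len v) + real (len (fst x \<circ> v)) \<le> affine_length D \<rho> x"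
    using eq by linarith
  have fin: "finite ?S" using w \<mu> v tits_cone_finite finite_inversions by simp
  have "(\<Sum>\<gamma>\<in>?S. length_defect x v \<gamma>) = 0 \<longleftrightarrow> (\<forall>\<gamma>\<in>?S. length_defect x v \<gamma> = 0)"
    by (rule sum_nonneg_eq_0_iff[OF fin length_defect_nonneg])
  also have "\<dots> \<longleftrightarrow> (\<forall>\<gamma>\<in>pos. length_defect x v \<gamma> = 0)"
  proof (intro iffI ballI)
    fix \<gamma> assume *: "\<forall>\<gamma>\<in>?S. length_defect x v \<gamma> = 0" and \<gamma>: "\<gamma> \<in> pos"
    show "length_defect x v \<gamma> = 0"
    proof (cases "\<gamma> \<in> ?S")
      \<comment> \<open>Outside \<open>?S\<close> the root is positive under \<open>fst x\<close>
        and \<open>inv v\<close> and has a nonnegative value, so every term of the defect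
        vanishes.\<close>
      case False
      then show ?thesis using \<gamma> w v by (auto simp: length_defect_def inversion_iff)
    qed (use * in blast)
  qed (auto simp: inversions_def)
  also have "\<dots> \<longleftrightarrow> v \<in> length_positive D x"
    unfolding length_positive_iff[OF v] using length_defect_eq_0_iff[OF w] by blast
  finally show "affine_length D \<rho> x = 2 * \<rho> (inv v (snd x)) - real (len v) + real (len (fst x \<circ> v))
      \<longleftrightarrow> v \<in> length_positive D x"
    using eq by linarith
qed

end

end

lemma path_weight_Nil [simp]: "path_weight [] = 0"
  and path_weight_Cons [simp]: "path_weight (e # p) = fst (snd e) + path_weight p"
  by (simp_all add: path_weight_def)

context kac_moody_root_datum
begin

section \<open>The root functional on sums of roots\<close>

definition pos_ind :: "'p \<Rightarrow> int" where
  "pos_ind \<beta> = of_bool (\<beta> \<in> pos)"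

lemma pos_ind_simps [simp]: "\<beta> \<in> pos \<Longrightarrow> pos_ind \<beta> = 1" "\<beta> \<notin> pos \<Longrightarrow> pos_ind \<beta> = 0"
  by (simp_all add: pos_ind_def)

lemma len_comp_srefl:
  assumes "w \<in> W" "i \<in> I"
  shows "int (len (w \<circ> srefl i)) = int (len w) - 1 + 2 * pos_ind (act w (rt i))"
  using act_rt_pos_iff[OF assms] by (cases "act w (rt i) \<in> pos") auto

lemma pos_ind_comp_srefl:
  assumes "w \<in> W" "i \<in> I"
  shows "pos_ind (act (w \<circ> srefl i) (rt i)) = 1 - pos_ind (act w (rt i))"
  unfolding act_comp_srefl_rt[OF assms] pos_ind_def
  using neg_pos_iff[OF rootI[OF assms]] by simp

lemma root_length_alt:
  "root_length D x \<beta> = pr \<beta> (snd x) + pos_ind \<beta> - pos_ind (act (fst x) \<beta>)"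
  by (simp add: root_length_def pos_ind_def)

text \<open>Adding a positive root preserves positivity and adding a negative one cannot create it.
  The lower bound \<open>- k\<close> is attained when \<open>a\<close> and \<open>c\<close> are both
  positive.\<close>

lemma pos_ind_defect:
  assumes "a \<in> roots D" "c \<in> roots D" "a + zsmul k c \<in> roots D" "1 \<le> k"
  shows "- k \<le> pos_ind (a + zsmul k c) - pos_ind a - k * pos_ind c"
    and "pos_ind (a + zsmul k c) - pos_ind a - k * pos_ind c \<le> 0"
proof -
  have up: "a + zsmul k c \<in> pos" if "c \<in> pos" "a \<in> pos"
    using that assms nonneg_comb_add nonneg_comb_zsmul[of rt c k] by (simp add: pos_roots_alt)
  have down: "a \<in> pos" if "c \<notin> pos" "a + zsmul k c \<in> pos"
  proof -
    have "- c \<in> pos" using that neg_pos_iff assms by blast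
    then have "nonneg_comb rt (zsmul k (- c))"
      using nonneg_comb_zsmul[of rt "- c" k] assms(4) by (simp add: pos_roots_alt)
    then have "nonneg_comb rt ((a + zsmul k c) + zsmul k (- c))"
      using that(2) unfolding pos_roots_alt by (blast intro: nonneg_comb_add)
    then show ?thesis using assms(1) by (simp add: pos_roots_alt)
  qed
  have "- k \<le> pos_ind (a + zsmul k c) - pos_ind a - k * pos_ind c \<and>
      pos_ind (a + zsmul k c) - pos_ind a - k * pos_ind c \<le> 0"
    by (cases "c \<in> pos"; cases "a \<in> pos"; cases "a + zsmul k c \<in> pos")
      (use up down assms(4) in \<open>simp_all\<close>)
  then show "- k \<le> pos_ind (a + zsmul k c) - pos_ind a - k * pos_ind c"
    and "pos_ind (a + zsmul k c) - pos_ind a - k * pos_ind c \<le> 0" by auto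
qed

text \<open>The defect of the indicator at the roots enters with a plus sign and loses at most
  \<open>k\<close>; the one at their images enters with a minus sign and loses nothing. Value 1 at
  \<open>c\<close> therefore compensates exactly.\<close>

lemma root_length_add_ge:
  assumes "fst z \<in> W" "a \<in> roots D" "c \<in> roots D" "a + zsmul k c \<in> roots D" "1 \<le> k"
  shows "root_length D z a + k * root_length D z c - k \<le> root_length D z (a + zsmul k c)"
proof -
  have roots: "act (fst z) a \<in> roots D" "act (fst z) c \<in> roots D"
      "act (fst z) a + zsmul k (act (fst z) c) \<in> roots D"
    using act_root[OF assms(1)] assms by (simp_all flip: act_zsmul act_add)
  show ?thesis
    using pos_ind_defect(1)[OF assms(2-5)] pos_ind_defect(2)[OF roots assms(5)] assms(1)
    by (simp add: root_length_alt act_add act_zsmul pr_simps algebra_simps)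
qed

text \<open>A positive root pairs to 2 with its coroot, which is a nonnegative combination of simple
  coroots. Reflecting in the resulting \<open>j\<close> lowers the height.\<close>

lemma pos_root_lower:
  assumes "\<beta> \<in> pos"
  obtains j where "j \<in> I" "0 < pr \<beta> (crt j)"
proof -
  obtain m :: "'i \<Rightarrow> nat" where m: "coroot D \<beta> = (\<Sum>j\<in>I. zsmul (int (m j)) (crt j))"
    using coroot_pos[OF assms] by (auto simp: nonneg_comb_def)
  have "2 = (\<Sum>j\<in>I. int (m j) * pr \<beta> (crt j))"
    using pr_coroot[OF pos_root[OF assms]] by (simp add: m pr_sum_right pr_zsmul_right)
  then have "\<not> (\<forall>j\<in>I. pr \<beta> (crt j) \<le> 0)"
    using sum_nonpos[of I "\<lambda>j. int (m j) * pr \<beta> (crt j)"] by (force simp: mult_nonneg_nonpos)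
  then show thesis using that by (auto simp: not_le)
qed

text \<open>Length positivity only involves simple roots if it is known for sufficiently many \<open>v\<close>: if
  \<open>\<beta> = \<beta>' + k \<alpha>\<close> with \<open>\<alpha>\<close> simple, then either the value at \<open>v \<alpha>\<close> is positive and compensates for the
  failure of additivity of the root functional, or one can pass from \<open>(v, \<beta>)\<close> to
  \<open>(v s\<^sub>\<alpha>, \<beta>')\<close>.\<close>

lemma length_positive_from_simple:
  assumes z: "fst z \<in> W" and Q: "Q \<subseteq> W" and "v \<in> Q"
    and step: "\<And>v i. v \<in> Q \<Longrightarrow> i \<in> I \<Longrightarrow> 1 \<le> root_length D z (act v (rt i)) \<or>
      root_length D z (act v (rt i)) = 0 \<and> v \<circ> srefl i \<in> Q"
  shows "v \<in> length_positive D z"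
proof -
  have main: "0 \<le> root_length D z (act v \<beta>)"
    if "v \<in> Q" "\<beta> \<in> pos" "\<beta> = (\<Sum>i\<in>I. zsmul (int (n i)) (rt i))" for v \<beta> and n :: "'i \<Rightarrow> nat"
    using that
  proof (induction "\<Sum>i\<in>I. n i" arbitrary: v \<beta> n rule: less_induct)
    case less
    have v: "v \<in> W" using less.prems Q by blast
    obtain j where j: "j \<in> I" "0 < pr \<beta> (crt j)" using pos_root_lower less.prems by blast
    show ?case
    proof (cases "\<beta> = rt j")
      case True
      then show ?thesis using step[OF less.prems(1) j(1)] by auto
    next
      case False
      let ?\<beta> = "act (srefl j) \<beta>" and ?k = "pr \<beta> (crt j)"
      have \<beta>': "?\<beta> \<in> pos" using srefl_pos less.prems False j by blast
      then obtain m :: "'i \<Rightarrow> nat" where m: "?\<beta> = (\<Sum>i\<in>I. zsmul (int (m i)) (rt i))"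
        by (auto simp: pos_roots_alt nonneg_comb_def)
      have \<beta>: "\<beta> = ?\<beta> + zsmul ?k (rt j)" using j by (simp add: act_srefl)
      have "(\<Sum>i\<in>I. zsmul (int (m i) + (if i = j then ?k else 0)) (rt i)) = \<beta>"
        unfolding zsmul_add_left sum.distrib sum_single[OF j(1)] m[symmetric] using \<beta> by simp
      then have "(\<Sum>i\<in>I. zsmul (int (m i) + (if i = j then ?k else 0)) (rt i)) =
          (\<Sum>i\<in>I. zsmul (int (n i)) (rt i))"
        using less.prems(3) by simp
      from rt_coeffs_eq[OF this] have "int (m i) + (if i = j then ?k else 0) = int (n i)" if "i \<in> I" for i
        using that by blast
      then have "m j < n j" "\<And>i. i \<in> I \<Longrightarrow> m i \<le> n i" using j by (force split: if_splits)+
      then have smaller: "(\<Sum>i\<in>I. m i) < (\<Sum>i\<in>I. n i)"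
        using j finite_I by (intro sum_strict_mono_ex1) auto
      note IH = less.hyps[OF smaller _ \<beta>' m]
      consider "1 \<le> root_length D z (act v (rt j))" | "v \<circ> srefl j \<in> Q"
        using step[OF less.prems(1) j(1)] by blast
      then show ?thesis
      proof cases
        case 1
        have eq: "act v \<beta> = act v ?\<beta> + zsmul ?k (act v (rt j))"
          by (subst \<beta>) (simp only: act_add[OF v] act_zsmul[OF v])
        have "root_length D z (act v ?\<beta>) + ?k * root_length D z (act v (rt j)) - ?k \<le>
            root_length D z (act v \<beta>)"
          unfolding eq
          by (rule root_length_add_ge[OF z act_root[OF v pos_root[OF \<beta>']] rootI[OF v j(1)]])
            (use act_root[OF v pos_root[OF less.prems(2)]] j(2) in \<open>simp_all flip: eq\<close>)
        moreover have "?k \<le> ?k * root_length D z (act v (rt j))" using 1 j(2) by simp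
        ultimately show ?thesis using IH[OF less.prems(1)] by linarith
      next
        case 2
        have "act (v \<circ> srefl j) ?\<beta> = act v \<beta>"
          using v j by (subst act_comp) simp_all
        then show ?thesis using IH[OF 2] by (simp only:)
      qed
    qed
  qed
  have "0 \<le> root_length D z (act v \<beta>)" if \<beta>: "\<beta> \<in> pos" for \<beta>
  proof -
    obtain n :: "'i \<Rightarrow> nat" where "\<beta> = (\<Sum>i\<in>I. zsmul (int (n i)) (rt i))"
      using \<beta> by (auto simp: pos_roots_alt nonneg_comb_def)
    then show ?thesis by (rule main[OF \<open>v \<in> Q\<close> \<beta>])
  qed
  then show ?thesis using assms(2,3) by (auto simp: length_positive_def)
qed

section \<open>The quantum Bruhat graph\<close>

context
  fixes \<rho> :: "'q \<Rightarrow> real"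
  assumes rho: "is_rho D \<rho>"
begin

abbreviation walk :: "('q \<Rightarrow> 'q) \<Rightarrow> 'q qbg_arc list \<Rightarrow> ('q \<Rightarrow> 'q) \<Rightarrow> bool" where
  "walk \<equiv> pre_digraph.awalk (qbg D \<rho>)"

text \<open>One length equation covers both kinds of edges, as \<rho> vanishes at weight 0. The
  label \<gamma> is explicit because the weight of a Bruhat arc does not record it.\<close>

definition edge_via :: "'p \<Rightarrow> ('q \<Rightarrow> 'q) \<Rightarrow> 'q \<Rightarrow> ('q \<Rightarrow> 'q) \<Rightarrow> bool" where
  "edge_via \<gamma> u \<omega> w \<longleftrightarrow> u \<in> W \<and> \<gamma> \<in> pos \<and> w = u \<circ> rfl \<gamma> \<and> (\<omega> = 0 \<or> \<omega> = coroot D \<gamma>) \<and>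
     real (len w) = real (len u) + 1 - 2 * \<rho> \<omega>"

lemma arcs_qbg: "e \<in> arcs (qbg D \<rho>) \<longleftrightarrow> (\<exists>\<gamma>. edge_via \<gamma> (fst e) (fst (snd e)) (snd (snd e)))"
proof -
  have [simp]: "\<rho> 0 = 0" by (rule additive.zero[OF rho_additive[OF rho]])
  have nat: "real m = real n + 1 \<longleftrightarrow> m = n + 1" for m n by linarith
  show ?thesis
    by (cases e) (auto simp: qbg_def bruhat_arcs_def quantum_arcs_def edge_via_def nat simp del: comp_apply)
qed

lemma edge_via_W:
  assumes "edge_via \<gamma> u \<omega> w"
  shows "u \<in> W" "w \<in> W" "\<gamma> \<in> pos" "\<gamma> \<in> roots D" "w = u \<circ> rfl \<gamma>"
  using assms pos_root[of \<gamma>] by (auto simp: edge_via_def simp del: comp_apply)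

lemma walk_Nil [simp]: "walk u [] w \<longleftrightarrow> u = w \<and> u \<in> W"
  by (auto simp: pre_digraph.awalk_def pre_digraph.cas.simps qbg_def)

lemma walk_Cons:
  "walk u (e # p) w \<longleftrightarrow> (\<exists>\<gamma>. edge_via \<gamma> u (fst (snd e)) (snd (snd e))) \<and> fst e = u \<and> walk (snd (snd e)) p w"
proof -
  have "head (qbg D \<rho>) e = snd (snd e)" "tail (qbg D \<rho>) e = fst e" "verts (qbg D \<rho>) = W"
    by (simp_all add: qbg_def)
  then show ?thesis
    by (auto simp: pre_digraph.awalk_def pre_digraph.cas.simps arcs_qbg dest: edge_via_W)
qed

lemma walk_W: "walk u p w \<Longrightarrow> u \<in> W \<and> w \<in> W"
  by (induction p arbitrary: u) (auto simp: walk_Cons dest: edge_via_W)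

lemma walk_len: "walk u p w \<Longrightarrow> real (len w) = real (len u) + real (length p) - 2 * \<rho> (path_weight p)"
  by (induction p arbitrary: u)
    (fastforce simp: walk_Cons edge_via_def rho_add[OF rho] additive.zero[OF rho_additive[OF rho]])+

section \<open>Connectedness and distance\<close>

definition reach :: "('q \<Rightarrow> 'q) \<Rightarrow> nat \<Rightarrow> ('q \<Rightarrow> 'q) \<Rightarrow> bool" where
  "reach u n w \<longleftrightarrow> (\<exists>p. walk u p w \<and> length p = n)"

lemma reach_0 [simp]: "reach u 0 w \<longleftrightarrow> u = w \<and> u \<in> W"
  by (simp add: reach_def)

lemma reach_Suc: "edge_via \<gamma> u \<omega> v \<Longrightarrow> reach v n w \<Longrightarrow> reach u (Suc n) w"
  unfolding reach_def by (metis walk_Cons fst_conv snd_conv length_Cons)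

text \<open>A descent is a quantum edge because \<rho> is 1 on simple coroots. Hence every word is a
  walk and the graph is strongly connected.\<close>

lemma edge_via_simple:
  assumes "u \<in> W" "i \<in> I"
  shows "edge_via (rt i) u (if act u (rt i) \<in> pos then 0 else crt i) (u \<circ> srefl i)"
  using assms act_rt_pos_iff[OF assms] rt_pos rho_crt[OF rho] additive.zero[OF rho_additive[OF rho]]
  by (auto simp: edge_via_def refl_rt coroot_rt simp del: comp_apply)

lemma reach_word:
  "is \<in> lists I \<Longrightarrow> u \<in> W \<Longrightarrow> reach u (length is) (u \<circ> word_prod D is)"
proof (induction "is" arbitrary: u)
  case Nil
  then show ?case by simp
next
  case (Cons i "is")
  then have i: "i \<in> I" "is \<in> lists I" by auto
  have "u \<circ> srefl i \<in> W" using Cons.prems i by simp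
  then have "reach (u \<circ> srefl i) (length is) (u \<circ> srefl i \<circ> word_prod D is)" by (rule Cons.IH[OF i(2)])
  then show ?case using reach_Suc[OF edge_via_simple[OF Cons.prems(2) i(1)]]
    by (simp only: list.size word_prod_Cons o_assoc add_Suc_right add_0_right)
qed

lemma reach_exists:
  assumes "u \<in> W" "w \<in> W"
  shows "\<exists>n. reach u n w"
proof -
  obtain "is" where "is \<in> lists I" "word_prod D is = inv u \<circ> w"
    using reduced_word[of "inv u \<circ> w"] assms by auto
  moreover have "u \<circ> (inv u \<circ> w) = w" using assms by (simp add: fun_eq_iff)
  ultimately show ?thesis using reach_word[of "is" u] assms by metis
qed

lemma qbg_dist_alt: "qbg_dist D \<rho> u w = (LEAST n. reach u n w)"
  by (simp add: qbg_dist_def reach_def)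

lemma qbg_dist_le: "reach u n w \<Longrightarrow> qbg_dist D \<rho> u w \<le> n"
  unfolding qbg_dist_alt by (rule Least_le)

lemma shortest_path_exists:
  assumes "u \<in> W" "w \<in> W"
  shows "\<exists>p. shortest_path D \<rho> u p w"
proof -
  have "reach u (qbg_dist D \<rho> u w) w"
    unfolding qbg_dist_alt using reach_exists[OF assms] by (rule LeastI_ex)
  then show ?thesis by (auto simp: reach_def shortest_path_def)
qed

text \<open>The path's share of the root functional of the Demazure product at
  \<open>act v (rt i)\<close>; it telescopes along a walk.\<close>

definition gain :: "'i \<Rightarrow> ('q \<Rightarrow> 'q) \<Rightarrow> 'q \<Rightarrow> ('q \<Rightarrow> 'q) \<Rightarrow> int" where
  "gain i u \<omega> w = pos_ind (act w (rt i)) - pos_ind (act u (rt i)) - pr (rt i) \<omega>"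

lemma gain_simple_edge:
  assumes "edge_via (rt i) u \<omega> w" "i \<in> I"
  shows "gain i u \<omega> w = - 1"
proof -
  have u: "u \<in> W" and w: "w = u \<circ> srefl i" using edge_via_W[OF assms(1)] assms(2) by (simp_all add: refl_rt)
  have l: "int (len w) = int (len u) - 1 + 2 * pos_ind (act u (rt i))"
    and p: "pos_ind (act w (rt i)) = 1 - pos_ind (act u (rt i))"
    unfolding w using len_comp_srefl pos_ind_comp_srefl u assms(2) by blast+
  have "real (len w) = real (len u) + 1 - 2 * \<rho> \<omega>" and "\<omega> = 0 \<or> \<omega> = crt i"
    using assms by (auto simp: edge_via_def coroot_rt simp del: comp_apply)
  then consider "\<omega> = 0" "len w = len u + 1" | "\<omega> = crt i" "len w + 1 = len u"
    using rho_crt[OF rho assms(2)] additive.zero[OF rho_additive[OF rho]] by force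
  then show ?thesis
    using l p assms(2) by cases (auto simp: gain_def pr_simps pr_rt_crt cartan_diag)
qed

lemma comp_refl_comp_srefl:
  assumes "\<gamma> \<in> roots D" "i \<in> I"
  shows "u \<circ> rfl \<gamma> \<circ> srefl i = u \<circ> srefl i \<circ> rfl (act (srefl i) \<gamma>)"
  using assms by (simp add: refl_act fun_eq_iff srefl_srefl)

text \<open>Negative gain means that \<open>srefl i\<close> lengthens \<open>u\<close> and shortens
  \<open>w\<close>, so \<open>w \<circ> srefl i\<close> is shorter than
  \<open>u \<circ> srefl i\<close>. Yet the reflection joining these two goes up, since \<gamma>
  keeps its image under the transfer.\<close>

lemma gain_bruhat_nonneg:
  assumes e: "edge_via \<gamma> u 0 w" and i: "i \<in> I" and ne: "\<gamma> \<noteq> rt i"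
  shows "0 \<le> gain i u 0 w"
proof (rule ccontr)
  assume "\<not> 0 \<le> gain i u 0 w"
  then have P: "act u (rt i) \<in> pos" "act w (rt i) \<notin> pos"
    by (auto simp: gain_def pos_ind_def pr_simps split: if_splits)
  note W = edge_via_W[OF e]
  have "real (len w) = real (len u) + 1"
    using e additive.zero[OF rho_additive[OF rho]] by (auto simp: edge_via_def simp del: comp_apply)
  then have len: "len w = len u + 1" by linarith
  then have "act u \<gamma> \<in> pos" using len_comp_refl_less[OF W(1,3)] W(5) by force
  moreover have "act (u \<circ> srefl i) (act (srefl i) \<gamma>) = act u \<gamma>"
    using W(1) i by (subst act_comp) simp_all
  ultimately have "len (u \<circ> srefl i) < len (u \<circ> srefl i \<circ> rfl (act (srefl i) \<gamma>))"
    by (intro len_comp_refl_greater W_comp W_srefl W(1) i srefl_pos[OF W(3) i ne]) simp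
  also have "u \<circ> srefl i \<circ> rfl (act (srefl i) \<gamma>) = w \<circ> srefl i"
    unfolding W(5) by (rule comp_refl_comp_srefl[OF W(4) i, symmetric])
  finally show False
    using len P act_rt_pos_iff(1)[OF W(1) i] act_rt_pos_iff(2)[OF W(2) i] by linarith
qed

text \<open>If the image were positive, it would stay positive under \<open>srefl i\<close>; but the
  negative of the result is \<open>rt i\<close> plus a positive multiple of a positive root.\<close>

lemma refl_simple_root_neg:
  assumes "\<gamma> \<in> pos" "i \<in> I" "\<gamma> \<noteq> rt i" "0 < pr (rt i) (coroot D \<gamma>)"
  shows "act (rfl \<gamma>) (rt i) \<notin> pos"
proof
  let ?m = "pr (rt i) (coroot D \<gamma>)" and ?\<delta> = "act (rfl \<gamma>) (rt i)"
  assume \<delta>: "?\<delta> \<in> pos"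
  have eq: "?\<delta> = rt i - zsmul ?m \<gamma>" using assms pos_root by (simp add: act_refl)
  have "?\<delta> \<noteq> rt i"
  proof
    assume "?\<delta> = rt i"
    then have "zsmul ?m \<gamma> = 0" using eq by simp
    then have "pr (zsmul ?m \<gamma>) (coroot D \<gamma>) = 0" by (simp only: pr_zero_left)
    then show False using assms pos_root by (simp add: pr_simps pr_coroot)
  qed
  from srefl_pos[OF \<delta> assms(2) this] have 1: "act (srefl i) ?\<delta> \<in> pos" .
  have "- act (srefl i) ?\<delta> = rt i + zsmul ?m (act (srefl i) \<gamma>)"
    using assms(2) unfolding eq by (simp add: act_diff act_zsmul act_srefl_rt)
  moreover have "nonneg_comb rt \<dots>"
    using nonneg_comb_gen[OF assms(2), of rt] srefl_pos[OF assms(1-3)] assms(4)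
    by (intro nonneg_comb_add nonneg_comb_zsmul) (simp_all add: pos_roots_alt)
  moreover have "- act (srefl i) ?\<delta> \<in> roots D" using 1 by (simp add: pos_root)
  ultimately have "- act (srefl i) ?\<delta> \<in> pos" by (simp add: pos_roots_alt)
  then show False using 1 pos_not_neg by blast
qed

text \<open>A quantum edge is a length-additive factorization of \<open>u\<close> into
  \<open>w\<close> and the reflection. If \<open>?m\<close> is positive, then \<open>rt i\<close> is
  an inversion of the reflection, so \<open>?m\<close> is 1, and length additivity makes both
  indicators contribute in favour of the gain.\<close>

lemma gain_quantum_nonneg:
  assumes e: "edge_via \<gamma> u (coroot D \<gamma>) w" and i: "i \<in> I" and ne: "\<gamma> \<noteq> rt i"
  shows "0 \<le> gain i u (coroot D \<gamma>) w"
proof -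
  note W = edge_via_W[OF e]
  let ?m = "pr (rt i) (coroot D \<gamma>)"
  have r: "rfl \<gamma> \<in> W" using W by simp
  have u: "u = w \<circ> rfl \<gamma>" unfolding W(5) by (rule comp_refl_cancel[OF W(4), symmetric])
  have l: "real (len w) = real (len u) + 1 - 2 * \<rho> (coroot D \<gamma>)"
    using e unfolding edge_via_def by blast
  have le: "len u \<le> len w + len (rfl \<gamma>)" by (subst u) (rule len_comp_le[OF W(2) r])
  \<comment> \<open>The quantum length drop is at least \<open>len (rfl \<gamma>)\<close> by the
    general bound and at most that by subadditivity.\<close>
  have q: "2 * \<rho> (coroot D \<gamma>) = real (len (rfl \<gamma>)) + 1"
    using len_refl_bound(1)[OF rho W(3)] l le by linarith
  have len: "len u = len w + len (rfl \<gamma>)" using l q by linarith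
  consider "?m \<le> - 1" | "?m = 0" | "0 < ?m" by linarith
  then show ?thesis
  proof cases
    case 1
    then show ?thesis by (simp add: gain_def pos_ind_def)
  next
    case 2
    have "act (rfl \<gamma>) (rt i) = rt i" using 2 W(4) by (simp add: act_refl)
    then have "act w (rt i) = act u (rt i)" unfolding W(5) by (simp only: act_comp[OF W(1) r])
    then show ?thesis using 2 by (simp add: gain_def)
  next
    case 3
    have neg: "act (rfl \<gamma>) (rt i) \<notin> pos" by (rule refl_simple_root_neg[OF W(3) i ne 3])
    then have "rt i \<in> inversions D (rfl \<gamma>)" using r i rt_pos by (simp add: inversion_iff)
    then have m: "?m = 1" using len_refl_bound(2)[OF rho W(3) q] ne by blast
    have short: "Suc (len (rfl \<gamma> \<circ> srefl i)) = len (rfl \<gamma>)" using act_rt_pos_iff(2)[OF r i] neg by blast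
    have rs: "rfl \<gamma> \<circ> srefl i \<in> W" using r i by simp
    have "len (u \<circ> srefl i) \<le> len w + len (rfl \<gamma> \<circ> srefl i)"
      using len_comp_le[OF W(2) rs] by (subst u) (simp only: comp_assoc)
    then have "act u (rt i) \<notin> pos" using act_rt_pos_iff(1)[OF W(1) i] len short by linarith
    \<comment> \<open>If \<open>srefl i\<close> shortened \<open>w\<close>, it could be cancelled
      between \<open>w\<close> and the reflection, which it shortens on the left as on the right
      because the reflection is an involution.\<close>
    moreover have "act w (rt i) \<in> pos"
    proof (rule ccontr)
      assume "act w (rt i) \<notin> pos"
      then have ws: "Suc (len (w \<circ> srefl i)) = len w" using act_rt_pos_iff(2)[OF W(2) i] by blast
      have "inv (rfl \<gamma> \<circ> srefl i) = srefl i \<circ> rfl \<gamma>"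
        using r i W(4) by (simp only: W_inv_comp W_srefl inv_refl inv_srefl)
      then have "len (srefl i \<circ> rfl \<gamma>) = len (rfl \<gamma> \<circ> srefl i)" using len_inv[OF rs] by simp
      moreover have "u = w \<circ> srefl i \<circ> (srefl i \<circ> rfl \<gamma>)"
        unfolding u using i by (simp add: fun_eq_iff srefl_srefl)
      then have "len u \<le> len (w \<circ> srefl i) + len (srefl i \<circ> rfl \<gamma>)"
        using len_comp_le[of "w \<circ> srefl i" "srefl i \<circ> rfl \<gamma>"] W(2) r i
        by (metis W_comp W_srefl)
      ultimately show False using len short ws by linarith
    qed
    ultimately show ?thesis using m by (simp add: gain_def)
  qed
qed

lemma gain_nonneg: "edge_via \<gamma> u \<omega> w \<Longrightarrow> i \<in> I \<Longrightarrow> \<gamma> \<noteq> rt i \<Longrightarrow> 0 \<le> gain i u \<omega> w"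
  using gain_bruhat_nonneg gain_quantum_nonneg edge_via_def by metis

text \<open>Gain 0 says that multiplying both endpoints by \<open>srefl i\<close> changes the length
  difference by exactly the amount by which \<open>- 2 * \<rho> \<omega>\<close> changes when
  \<omega> is reflected.\<close>

lemma edge_via_transfer:
  assumes e: "edge_via \<gamma> u \<omega> w" and i: "i \<in> I" and ne: "\<gamma> \<noteq> rt i" and gain: "gain i u \<omega> w = 0"
  shows "edge_via (act (srefl i) \<gamma>) (u \<circ> srefl i) (srefl i \<omega>) (w \<circ> srefl i)"
proof -
  note W = edge_via_W[OF e]
  have "int (len (w \<circ> srefl i)) - int (len w) =
      int (len (u \<circ> srefl i)) - int (len u) + 2 * pr (rt i) \<omega>"
    using len_comp_srefl[OF W(1) i] len_comp_srefl[OF W(2) i] gain by (simp add: gain_def del: comp_apply)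
  then have "real (len (w \<circ> srefl i)) - real (len w) =
      real (len (u \<circ> srefl i)) - real (len u) + 2 * real_of_int (pr (rt i) \<omega>)"
    by linarith
  moreover have "\<rho> (srefl i \<omega>) = \<rho> \<omega> - real_of_int (pr (rt i) \<omega>)"
    using i by (simp add: simple_reflection_def rho_diff[OF rho] rho_zsmul[OF rho] rho_crt[OF rho])
  moreover have "real (len w) = real (len u) + 1 - 2 * \<rho> \<omega>" using e unfolding edge_via_def by blast
  ultimately have "real (len (w \<circ> srefl i)) = real (len (u \<circ> srefl i)) + 1 - 2 * \<rho> (srefl i \<omega>)"
    by linarith
  moreover have "srefl i \<omega> = 0 \<or> srefl i \<omega> = coroot D (act (srefl i) \<gamma>)"
    using e i W(4) coroot_act[of "srefl i" \<gamma>] by (auto simp: edge_via_def W_zero)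
  moreover have "w \<circ> srefl i = u \<circ> srefl i \<circ> rfl (act (srefl i) \<gamma>)"
    unfolding W(5) by (rule comp_refl_comp_srefl[OF W(4) i])
  ultimately show ?thesis
    unfolding edge_via_def using srefl_pos[OF W(3) i ne] W(1) i by (simp del: comp_apply)
qed

text \<open>Steps of a walk that are not labelled by the simple root \<open>\<alpha>\<close> have nonnegative gain, and those of
  gain \<open>0\<close> can be moved across \<open>s\<^sub>\<alpha>\<close>. Each step labelled by \<open>\<alpha>\<close> has gain \<open>-1\<close>. Two such steps that are
  separated by steps of gain \<open>0\<close> only can be cancelled, so in a walk of minimal length they
  alternate with steps of positive gain.\<close>

lemma walk_srefl:
  assumes "walk u p w" "i \<in> I"
  shows "(\<exists>m. m < length p \<and> reach u m w) \<or>
    (gain i u (path_weight p) w = 0 \<and>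
      (\<exists>q. walk (u \<circ> srefl i) q (w \<circ> srefl i) \<and> length q = length p \<and>
        path_weight q = srefl i (path_weight p))) \<or>
    (\<exists>n. length p = Suc n \<and> - 1 \<le> gain i u (path_weight p) w \<and>
      reach (u \<circ> srefl i) n w \<and> reach u n (w \<circ> srefl i)) \<or>
    (\<exists>n. length p = Suc n \<and> 0 \<le> gain i u (path_weight p) w \<and> reach (u \<circ> srefl i) n w) \<or>
    (\<exists>n. length p = Suc n \<and> 0 \<le> gain i u (path_weight p) w \<and> reach u n (w \<circ> srefl i)) \<or>
    1 \<le> gain i u (path_weight p) w"
    (is "?short u p \<or> ?zero u p \<or> ?both u p \<or> ?left u p \<or> ?right u p \<or> ?positive u p")
  using assms(1)
proof (induction p arbitrary: u)
  case Nil
  then have "?zero u []"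
    using assms(2) by (intro conjI exI[of _ "[]"]) (auto simp: gain_def pr_simps W_zero simp del: comp_apply)
  then show ?case by blast
next
  case (Cons e p)
  let ?u = "snd (snd e)" and ?\<omega> = "fst (snd e)"
  obtain \<gamma> where e: "edge_via \<gamma> u ?\<omega> ?u" and p: "walk ?u p w" using Cons.prems by (auto simp: walk_Cons)
  note W = edge_via_W[OF e]
  have wW: "w \<in> W" using walk_W[OF p] by blast
  define g where "g = gain i ?u (path_weight p) w"
  have gain: "gain i u (path_weight (e # p)) w = gain i u ?\<omega> ?u + g"
    by (simp add: gain_def g_def pr_simps)
  note IH = Cons.IH[OF p, folded g_def]
  have step: "reach ?u n v \<Longrightarrow> reach u (Suc n) v" for n v by (rule reach_Suc[OF e])
  show ?case
  proof (cases "\<gamma> = rt i")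
    case True
    then have u: "u = ?u \<circ> srefl i" and us: "u \<circ> srefl i = ?u"
      using W(5) assms(2) by (simp_all only: refl_rt comp_srefl_cancel)
    have gain': "gain i u (path_weight (e # p)) w = g - 1"
      using gain gain_simple_edge[of i u] e True assms(2) by simp
    have here: "reach (u \<circ> srefl i) (length p) w" unfolding us using p by (auto simp: reach_def)
    \<comment> \<open>Since \<open>?u \<circ> srefl i\<close> is \<open>u\<close>, a transferred
      walk already starts at \<open>u\<close> and bypasses the first edge. If it also ends at
      \<open>w\<close>, the whole walk is not shortest.\<close>
    from IH consider "\<exists>m. m < length p \<and> reach ?u m w"
      | "g = 0" "reach u (length p) (w \<circ> srefl i)"
      | n where "length p = Suc n" "reach u n w"
      | n where "length p = Suc n" "0 \<le> g" "reach ?u n (w \<circ> srefl i)"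
      | "1 \<le> g"
      unfolding u[symmetric] reach_def by blast
    then show ?thesis
    proof cases
      case 1
      then have "?short u (e # p)" using step by fastforce
      then show ?thesis by blast
    next
      case 2
      then have "?both u (e # p)" using here gain' by (simp del: comp_apply)
      then show ?thesis by blast
    next
      case 3
      then have "?short u (e # p)" by (intro exI[of _ n]) simp
      then show ?thesis by blast
    next
      case 4
      then have "?both u (e # p)" using here gain' step[of n "w \<circ> srefl i"] by (simp del: comp_apply)
      then show ?thesis by blast
    next
      case 5
      then have "?left u (e # p)" using here gain' by (simp del: comp_apply)
      then show ?thesis by blast
    qed
  next
    case False
    have nonneg: "0 \<le> gain i u ?\<omega> ?u" by (rule gain_nonneg[OF e assms(2) False])
    show ?thesis
    proof (cases "gain i u ?\<omega> ?u = 0")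
      case True
      have gain': "gain i u (path_weight (e # p)) w = g" using gain True by simp
      have e': "edge_via (act (srefl i) \<gamma>) (u \<circ> srefl i) (srefl i ?\<omega>) (?u \<circ> srefl i)"
        by (rule edge_via_transfer[OF e assms(2) False True])
      have step': "reach (?u \<circ> srefl i) n v \<Longrightarrow> reach (u \<circ> srefl i) (Suc n) v" for n v
        by (rule reach_Suc[OF e'])
      from IH consider "\<exists>m. m < length p \<and> reach ?u m w"
        | q where "g = 0" "walk (?u \<circ> srefl i) q (w \<circ> srefl i)" "length q = length p"
            "path_weight q = srefl i (path_weight p)"
        | n where "length p = Suc n" "- 1 \<le> g" "reach (?u \<circ> srefl i) n w" "reach ?u n (w \<circ> srefl i)"
        | n where "length p = Suc n" "0 \<le> g" "reach (?u \<circ> srefl i) n w"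
        | n where "length p = Suc n" "0 \<le> g" "reach ?u n (w \<circ> srefl i)"
        | "1 \<le> g"
        by blast
      then show ?thesis
      proof cases
        case 1
        then have "?short u (e # p)" using step by fastforce
        then show ?thesis by blast
      next
        case 2
        have "walk (u \<circ> srefl i) ((u \<circ> srefl i, srefl i ?\<omega>, ?u \<circ> srefl i) # q) (w \<circ> srefl i)"
          unfolding walk_Cons fst_conv snd_conv using e' 2(2) by blast
        then have "?zero u (e # p)"
          using gain' 2 W_add[OF W_srefl[OF assms(2)]]
          by (intro conjI exI[of _ "(u \<circ> srefl i, srefl i ?\<omega>, ?u \<circ> srefl i) # q"])
            (simp_all del: comp_apply)
        then show ?thesis by blast
      next
        case 3
        then have "?both u (e # p)" using gain' step step' by (simp del: comp_apply)
        then show ?thesis by blast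
      next
        case 4
        then have "?left u (e # p)" using gain' step' by (simp del: comp_apply)
        then show ?thesis by blast
      next
        case 5
        then have "?right u (e # p)" using gain' step by (simp del: comp_apply)
        then show ?thesis by blast
      next
        case 6
        then have "?positive u (e # p)" using gain' by simp
        then show ?thesis by blast
      qed
    next
      case g1: False
      have gain': "g + 1 \<le> gain i u (path_weight (e # p)) w" using gain nonneg g1 by linarith
      \<comment> \<open>The positive step lifts -1 to at least 0, where a single shortcut is enough,
        and lifts everything else to at least 1.\<close>
      from IH consider "\<exists>m. m < length p \<and> reach ?u m w"
        | n where "length p = Suc n" "- 1 \<le> g" "reach ?u n (w \<circ> srefl i)"
        | "0 \<le> g"
        by fastforce
      then show ?thesis
      proof cases
        case 1
        then have "?short u (e # p)" using step by fastforce
        then show ?thesis by blast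
      next
        case 2
        then have "?right u (e # p)" using gain' step by (simp del: comp_apply)
        then show ?thesis by blast
      next
        case 3
        then have "?positive u (e # p)" using gain' by linarith
        then show ?thesis by blast
      qed
    qed
  qed
qed


section \<open>The generalised Demazure product\<close>

lemma demazure_pairsD:
  assumes "(u, v) \<in> demazure_pairs D \<rho> x y"
  shows "u \<in> length_positive D x" "v \<in> length_positive D y" "u \<in> W" "v \<in> W"
    and "\<And>u' v'. u' \<in> length_positive D x \<Longrightarrow> v' \<in> length_positive D y \<Longrightarrow>
      qbg_dist D \<rho> u (fst y \<circ> v) \<le> qbg_dist D \<rho> u' (fst y \<circ> v')"
  using assms length_positive_W[of u x] length_positive_W[of v y] by (auto simp: demazure_pairs_def)

lemma demazure_pairs_nonempty:
  assumes "x \<in> affine_weyl_semigroup D" "y \<in> affine_weyl_semigroup D"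
  shows "demazure_pairs D \<rho> x y \<noteq> {}"
proof -
  obtain u0 v0 where "u0 \<in> length_positive D x" "v0 \<in> length_positive D y"
    using length_positive_nonempty assms by blast
  from ex_has_least_nat[of "\<lambda>(u, v). u \<in> length_positive D x \<and> v \<in> length_positive D y" "(u0, v0)"
      "\<lambda>(u, v). qbg_dist D \<rho> u (fst y \<circ> v)"] this
  show ?thesis unfolding demazure_pairs_def by fast
qed

text \<open>The indicators at \<open>act u \<beta>\<close> and
  \<open>act (fst y \<circ> v) \<beta>\<close> occur in the functionals of \<open>x\<close> and
  \<open>y\<close> but not in that of the product; with the path weight they make up the third
  term.\<close>

lemma root_length_demazure_via:
  assumes "fst x \<in> W" "fst y \<in> W" "u \<in> W" "v \<in> W"
  shows "root_length D (demazure_via x y u v p) (act v \<beta>) =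
    root_length D x (act u \<beta>) + root_length D y (act v \<beta>) +
    (pos_ind (act (fst y \<circ> v) \<beta>) - pos_ind (act u \<beta>) - pr \<beta> (path_weight p))"
proof -
  have "act (fst x \<circ> u \<circ> inv v) (act v \<beta>) = act (fst x) (act u \<beta>)"
    using assms by (simp add: act_comp del: comp_apply)
  moreover have "act (fst y \<circ> v) \<beta> = act (fst y) (act v \<beta>)"
    using assms by (simp add: act_comp del: comp_apply)
  moreover have "pr (act v \<beta>) (v (inv u (snd x)) + snd y - v (path_weight p)) =
      pr (act u \<beta>) (snd x) + pr (act v \<beta>) (snd y) - pr \<beta> (path_weight p)"
    using assms by (simp add: pr_simps pr_act[of u])
  ultimately show ?thesis
    unfolding root_length_alt demazure_via_def fst_conv snd_conv by (simp del: comp_apply)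
qed

text \<open>With \<open>r = a + b + g\<close>, each alternative of \<open>walk_srefl\<close> for a
  shortest path is settled: two shortcuts give \<open>a, b \<ge> 1\<close> against
  \<open>g \<ge> -1\<close>, one shortcut gives one of them against \<open>g \<ge> 0\<close>, and
  \<open>g \<ge> 1\<close> needs none. Only gain 0 allows \<open>r = 0\<close>, and there the path
  itself transfers.\<close>

lemma demazure_via_simple:
  assumes x: "x \<in> affine_weyl_semigroup D" and y: "y \<in> affine_weyl_semigroup D"
    and uv: "(u, v) \<in> demazure_pairs D \<rho> x y" and p: "shortest_path D \<rho> u p (fst y \<circ> v)"
    and i: "i \<in> I"
  defines "r \<equiv> root_length D (demazure_via x y u v p) (act v (rt i))"
  shows "1 \<le> r \<or> r = 0 \<and> (u \<circ> srefl i, v \<circ> srefl i) \<in> demazure_pairs D \<rho> x y \<and>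
    (\<exists>q. shortest_path D \<rho> (u \<circ> srefl i) q (fst y \<circ> (v \<circ> srefl i)) \<and>
      demazure_via x y (u \<circ> srefl i) (v \<circ> srefl i) q = demazure_via x y u v p)"
proof -
  note M = demazure_pairsD[OF uv]
  let ?w = "fst y \<circ> v" and ?d = "qbg_dist D \<rho> u (fst y \<circ> v)"
  have W: "fst x \<in> W" "fst y \<in> W" "?w \<in> W"
    using x y M by (auto simp: affine_weyl_semigroup_def simp del: comp_apply)
  have walk: "walk u p ?w" and len: "length p = ?d" using p by (simp_all add: shortest_path_def)
  define a where "a = root_length D x (act u (rt i))"
  define b where "b = root_length D y (act v (rt i))"
  define g where "g = gain i u (path_weight p) ?w"
  have ab: "0 \<le> a" "0 \<le> b"
    using M(1,2) length_positiveD rt_pos[OF i] by (auto simp: a_def b_def)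
  have r: "r = a + b + g"
    unfolding r_def a_def b_def g_def gain_def by (rule root_length_demazure_via[OF W(1,2) M(3,4)])
  have a0: "u \<circ> srefl i \<in> length_positive D x" if "a = 0"
    using length_positive_srefl[OF x M(1) i] that by (simp add: a_def)
  have b0: "v \<circ> srefl i \<in> length_positive D y" if "b = 0"
    using length_positive_srefl[OF y M(2) i] that by (simp add: b_def)
  have assoc: "fst y \<circ> (v \<circ> srefl i) = ?w \<circ> srefl i" by (simp only: comp_assoc)
  have not_short: "\<not> reach u m ?w" if "m < ?d" for m using qbg_dist_le that by fastforce
  \<comment> \<open>If \<open>a\<close> were 0, \<open>u \<circ> srefl i\<close> would be an
    admissible first component at smaller distance.\<close>
  have a1: "1 \<le> a" if "?d = Suc n" "reach (u \<circ> srefl i) n ?w" for n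
    using a0 ab M(5)[OF _ M(2)] qbg_dist_le[OF that(2)] that(1) by force
  have b1: "1 \<le> b" if "?d = Suc n" "reach u n (?w \<circ> srefl i)" for n
    using b0 ab M(5)[OF M(1)] qbg_dist_le[OF that(2)] that(1) unfolding assoc[symmetric] by force
  have zero: ?thesis if "g = 0" and q: "walk (u \<circ> srefl i) q (?w \<circ> srefl i)" "length q = ?d"
    "path_weight q = srefl i (path_weight p)" for q
  proof (cases "r = 0")
    case True
    then have "a = 0" "b = 0" using r ab \<open>g = 0\<close> by linarith+
    then have LP: "u \<circ> srefl i \<in> length_positive D x" "v \<circ> srefl i \<in> length_positive D y"
      using a0 b0 by auto
    have dist: "qbg_dist D \<rho> (u \<circ> srefl i) (fst y \<circ> (v \<circ> srefl i)) = ?d"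
    proof (rule antisym)
      show "qbg_dist D \<rho> (u \<circ> srefl i) (fst y \<circ> (v \<circ> srefl i)) \<le> ?d"
        unfolding assoc using q(1,2) by (intro qbg_dist_le) (auto simp: reach_def)
      show "?d \<le> qbg_dist D \<rho> (u \<circ> srefl i) (fst y \<circ> (v \<circ> srefl i))" by (rule M(5)[OF LP])
    qed
    then have "(u \<circ> srefl i, v \<circ> srefl i) \<in> demazure_pairs D \<rho> x y"
      unfolding demazure_pairs_def using LP M(5) by (simp del: comp_apply)
    moreover have "shortest_path D \<rho> (u \<circ> srefl i) q (fst y \<circ> (v \<circ> srefl i))"
      unfolding shortest_path_def dist using q(1,2) unfolding assoc by blast
    \<comment> \<open>The two copies of \<open>srefl i\<close> cancel between \<open>v\<close> and
      \<open>inv u\<close>, and \<open>v \<circ> srefl i\<close> undoes the reflection of the path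
      weight.\<close>
    moreover have "demazure_via x y (u \<circ> srefl i) (v \<circ> srefl i) q = demazure_via x y u v p"
      using q(3) M(3,4) i by (simp add: demazure_via_def W_inv_comp srefl_srefl fun_eq_iff)
    ultimately show ?thesis using True by blast
  qed (use r ab \<open>g = 0\<close> in linarith)
  from walk_srefl[OF walk i, folded g_def, unfolded len] show ?thesis
    using zero a1 b1 ab r not_short by (elim disjE exE conjE) (fastforce simp del: comp_apply)+
qed

text \<open>The set \<open>?Q\<close> collects the second components of all minimal pairs that give
  one fixed element; it is closed under the moves at simple roots of value 0.\<close>

lemma length_positive_demazure_via:
  assumes x: "x \<in> affine_weyl_semigroup D" and y: "y \<in> affine_weyl_semigroup D"
    and uv: "(u, v) \<in> demazure_pairs D \<rho> x y" and p: "shortest_path D \<rho> u p (fst y \<circ> v)"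
  shows "v \<in> length_positive D (demazure_via x y u v p)"
proof -
  let ?z = "demazure_via x y u v p"
  let ?Q = "{v. \<exists>u q. (u, v) \<in> demazure_pairs D \<rho> x y \<and> shortest_path D \<rho> u q (fst y \<circ> v) \<and>
    demazure_via x y u v q = ?z}"
  have "fst ?z \<in> W"
    using x demazure_pairsD(3,4)[OF uv]
    by (auto simp: demazure_via_def affine_weyl_semigroup_def simp del: comp_apply)
  moreover have "?Q \<subseteq> W" using demazure_pairsD(4) by blast
  moreover have "v \<in> ?Q" using uv p by blast
  moreover have "1 \<le> root_length D ?z (act v (rt i)) \<or>
      root_length D ?z (act v (rt i)) = 0 \<and> v \<circ> srefl i \<in> ?Q" if "v \<in> ?Q" "i \<in> I" for v i
  proof -
    from that(1) obtain u q where "(u, v) \<in> demazure_pairs D \<rho> x y"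
      "shortest_path D \<rho> u q (fst y \<circ> v)" "demazure_via x y u v q = ?z" by blast
    from demazure_via_simple[OF x y this(1,2) that(2)] this(3) show ?thesis
      by (metis (mono_tags, lifting) mem_Collect_eq)
  qed
  ultimately show ?thesis by (rule length_positive_from_simple)
qed

lemma affine_length_demazure_via:
  assumes x: "x \<in> affine_weyl_semigroup D" and y: "y \<in> affine_weyl_semigroup D"
    and uv: "(u, v) \<in> demazure_pairs D \<rho> x y" and p: "shortest_path D \<rho> u p (fst y \<circ> v)"
    and z: "demazure_via x y u v p \<in> affine_weyl_semigroup D"
  shows "affine_length D \<rho> (demazure_via x y u v p) =
    affine_length D \<rho> x + affine_length D \<rho> y - real (qbg_dist D \<rho> u (fst y \<circ> v))"
proof -
  let ?z = "demazure_via x y u v p"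
  note M = demazure_pairsD[OF uv]
  have "affine_length D \<rho> ?z = 2 * \<rho> (inv v (snd ?z)) - real (len v) + real (len (fst ?z \<circ> v))"
    using affine_length_ge(2)[OF rho z M(4)] length_positive_demazure_via[OF x y uv p] by blast
  moreover have "\<rho> (inv v (snd ?z)) = \<rho> (inv u (snd x)) + \<rho> (inv v (snd y)) - \<rho> (path_weight p)"
    using M(4) by (simp add: demazure_via_def W_add W_diff rho_add[OF rho] rho_diff[OF rho])
  moreover have "fst ?z \<circ> v = fst x \<circ> u"
    using M(4) by (simp add: demazure_via_def fun_eq_iff)
  moreover have "affine_length D \<rho> x = 2 * \<rho> (inv u (snd x)) - real (len u) + real (len (fst x \<circ> u))"
    using affine_length_ge(2)[OF rho x M(3)] M(1) by blast
  moreover have "affine_length D \<rho> y = 2 * \<rho> (inv v (snd y)) - real (len v) + real (len (fst y \<circ> v))"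
    using affine_length_ge(2)[OF rho y M(4)] M(2) by blast
  moreover have "real (len (fst y \<circ> v)) = real (len u) + real (length p) - 2 * \<rho> (path_weight p)"
    using walk_len[of u p "fst y \<circ> v"] p by (simp add: shortest_path_def del: comp_apply)
  moreover have "length p = qbg_dist D \<rho> u (fst y \<circ> v)" using p by (simp add: shortest_path_def)
  ultimately show ?thesis by (simp del: comp_apply)
qed

lemma demazure_via_Nil:
  assumes "fst y \<in> W" "v \<in> W"
  shows "demazure_via x y (fst y \<circ> v) v [] = affine_mult x y"
  using assms by (simp add: demazure_via_def affine_mult_def W_inv_comp W_zero fun_eq_iff)

text \<open>For \<open>v\<close> length positive for the product, its length is the sum of the lower
  bounds for \<open>x\<close> at \<open>fst y \<circ> v\<close> and for \<open>y\<close> at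
  \<open>v\<close>. Additivity makes both bounds sharp, and distance 0 is certainly minimal.\<close>

lemma length_additive_pair:
  assumes x: "x \<in> affine_weyl_semigroup D" and y: "y \<in> affine_weyl_semigroup D"
    and add: "affine_length D \<rho> (affine_mult x y) = affine_length D \<rho> x + affine_length D \<rho> y"
  obtains v where "(fst y \<circ> v, v) \<in> demazure_pairs D \<rho> x y"
    "shortest_path D \<rho> (fst y \<circ> v) [] (fst y \<circ> v)"
proof -
  note xy = affine_mult_closed[OF x y]
  obtain v where v: "v \<in> length_positive D (affine_mult x y)"
    using length_positive_nonempty[OF xy] by blast
  have vW: "v \<in> W" and yW: "fst y \<in> W" using v length_positive_W y by (auto simp: affine_weyl_semigroup_def)
  have yvW: "fst y \<circ> v \<in> W" using vW yW by simp
  have "affine_length D \<rho> (affine_mult x y) = 2 * \<rho> (inv v (snd (affine_mult x y))) - real (len v)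
      + real (len (fst (affine_mult x y) \<circ> v))"
    using affine_length_ge(2)[OF rho xy vW] v by blast
  moreover have "\<rho> (inv v (snd (affine_mult x y))) =
      \<rho> (inv (fst y \<circ> v) (snd x)) + \<rho> (inv v (snd y))"
    using vW yW by (simp add: affine_mult_def W_add W_inv_comp rho_add[OF rho])
  moreover have "fst (affine_mult x y) \<circ> v = fst x \<circ> (fst y \<circ> v)"
    by (simp add: affine_mult_def comp_assoc)
  ultimately have eq: "affine_length D \<rho> x + affine_length D \<rho> y =
      (2 * \<rho> (inv (fst y \<circ> v) (snd x)) - real (len (fst y \<circ> v)) + real (len (fst x \<circ> (fst y \<circ> v)))) +
      (2 * \<rho> (inv v (snd y)) - real (len v) + real (len (fst y \<circ> v)))"
    using add by (simp del: comp_apply)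
  have "fst y \<circ> v \<in> length_positive D x"
    using affine_length_ge(1)[OF rho y vW] affine_length_ge[OF rho x yvW] eq by linarith
  moreover have "v \<in> length_positive D y"
    using affine_length_ge[OF rho y vW] affine_length_ge(1)[OF rho x yvW] eq by linarith
  moreover have dist: "qbg_dist D \<rho> (fst y \<circ> v) (fst y \<circ> v) = 0"
    using qbg_dist_le[of "fst y \<circ> v" 0] yvW by (simp del: comp_apply)
  ultimately have "(fst y \<circ> v, v) \<in> demazure_pairs D \<rho> x y"
    by (simp add: demazure_pairs_def del: comp_apply)
  moreover have "shortest_path D \<rho> (fst y \<circ> v) [] (fst y \<circ> v)"
    using yvW dist by (simp add: shortest_path_def del: comp_apply)
  ultimately show thesis by (rule that)
qed

lemma demazure_well_definedD:
  assumes x: "x \<in> affine_weyl_semigroup D" and y: "y \<in> affine_weyl_semigroup D"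
    and wd: "demazure_well_defined D \<rho> x y"
    and uv: "(u, v) \<in> demazure_pairs D \<rho> x y" and p: "shortest_path D \<rho> u p (fst y \<circ> v)"
  shows "demazure_via x y u v p = demazure_product D \<rho> x y"
    and "demazure_product D \<rho> x y \<in> affine_weyl_semigroup D"
proof -
  obtain z where z: "z \<in> affine_weyl_semigroup D"
    and all: "\<And>u v p. (u, v) \<in> demazure_pairs D \<rho> x y \<Longrightarrow>
      shortest_path D \<rho> u p (fst y \<circ> v) \<Longrightarrow> demazure_via x y u v p = z"
    using wd unfolding demazure_well_defined_def by blast
  have "demazure_product D \<rho> x y = z"
    unfolding demazure_product_def by (rule the_equality) (use all uv p in blast)+
  then show "demazure_via x y u v p = demazure_product D \<rho> x y"
    and "demazure_product D \<rho> x y \<in> affine_weyl_semigroup D"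
    using all uv p z by auto
qed

lemma demazure_path_exists:
  assumes "y \<in> affine_weyl_semigroup D" "(u, v) \<in> demazure_pairs D \<rho> x y"
  obtains p where "shortest_path D \<rho> u p (fst y \<circ> v)"
proof -
  have "fst y \<circ> v \<in> W"
    using assms(1) demazure_pairsD(4)[OF assms(2)]
    by (auto simp: affine_weyl_semigroup_def simp del: comp_apply)
  then show thesis using that shortest_path_exists demazure_pairsD(3)[OF assms(2)] by blast
qed

lemma affine_length_demazure_product:
  assumes x: "x \<in> affine_weyl_semigroup D" and y: "y \<in> affine_weyl_semigroup D"
    and wd: "demazure_well_defined D \<rho> x y" and uv: "(u, v) \<in> demazure_pairs D \<rho> x y"
  shows "affine_length D \<rho> (demazure_product D \<rho> x y) =
    affine_length D \<rho> x + affine_length D \<rho> y - real (qbg_dist D \<rho> u (fst y \<circ> v))"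
proof -
  obtain p where p: "shortest_path D \<rho> u p (fst y \<circ> v)" using demazure_path_exists[OF y uv] .
  note z = demazure_well_definedD[OF x y wd uv p]
  show ?thesis using affine_length_demazure_via[OF x y uv p] z by simp
qed

text \<open>Either equation yields a minimal pair at distance 0, whose empty path computes the
  ordinary product. Taking both as alternatives gives the two directions of (i) at once.\<close>

lemma demazure_product_eq_mult:
  assumes x: "x \<in> affine_weyl_semigroup D" and y: "y \<in> affine_weyl_semigroup D"
    and wd: "demazure_well_defined D \<rho> x y"
    and add: "affine_length D \<rho> (affine_mult x y) = affine_length D \<rho> x + affine_length D \<rho> y \<or>
      affine_length D \<rho> (demazure_product D \<rho> x y) = affine_length D \<rho> x + affine_length D \<rho> y"
  shows "demazure_product D \<rho> x y = affine_mult x y"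
proof -
  have yW: "fst y \<in> W" using y by (auto simp: affine_weyl_semigroup_def)
  have "\<exists>v. (fst y \<circ> v, v) \<in> demazure_pairs D \<rho> x y \<and> shortest_path D \<rho> (fst y \<circ> v) [] (fst y \<circ> v)"
    using add
  proof
    assume "affine_length D \<rho> (affine_mult x y) = affine_length D \<rho> x + affine_length D \<rho> y"
    then show ?thesis using length_additive_pair[OF x y] by blast
  next
    assume add: "affine_length D \<rho> (demazure_product D \<rho> x y) = affine_length D \<rho> x + affine_length D \<rho> y"
    obtain u v where uv: "(u, v) \<in> demazure_pairs D \<rho> x y" using demazure_pairs_nonempty[OF x y] by fast
    obtain p where p: "shortest_path D \<rho> u p (fst y \<circ> v)" using demazure_path_exists[OF y uv] .
    have "qbg_dist D \<rho> u (fst y \<circ> v) = 0"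
      using add affine_length_demazure_product[OF x y wd uv] by linarith
    then have "p = []" using p by (simp add: shortest_path_def)
    moreover from this have "u = fst y \<circ> v" using p by (simp add: shortest_path_def)
    ultimately show ?thesis using uv p by blast
  qed
  then obtain v where v: "(fst y \<circ> v, v) \<in> demazure_pairs D \<rho> x y"
    "shortest_path D \<rho> (fst y \<circ> v) [] (fst y \<circ> v)" by blast
  show ?thesis
    using demazure_well_definedD(1)[OF x y wd v] demazure_via_Nil[OF yW demazure_pairsD(4)[OF v(1)]] by simp
qed

end

end

theorem theorem1p5:
  fixes D :: "('i, 'p::ab_group_add, 'q::ab_group_add) root_datum"
    and \<rho> :: "'q \<Rightarrow> real"
    and x y :: "'q affine"
  assumes "kac_moody_root_datum D"
    and "is_rho D \<rho>"
    and "x \<in> affine_weyl_semigroup D"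
    and "y \<in> affine_weyl_semigroup D"
    and "demazure_well_defined D \<rho> x y"
  shows "(affine_length D \<rho> (demazure_product D \<rho> x y) = affine_length D \<rho> x + affine_length D \<rho> y
           \<longleftrightarrow> affine_length D \<rho> (affine_mult x y) = affine_length D \<rho> x + affine_length D \<rho> y)
       \<and> (affine_length D \<rho> (affine_mult x y) = affine_length D \<rho> x + affine_length D \<rho> y
           \<longrightarrow> demazure_product D \<rho> x y = affine_mult x y)
       \<and> (\<forall>(u, v)\<in>demazure_pairs D \<rho> x y.
            affine_length D \<rho> (demazure_product D \<rho> x y)
              = affine_length D \<rho> x + affine_length D \<rho> y - real (qbg_dist D \<rho> u (fst y \<circ> v)))"
proof -
  interpret kac_moody_root_datum D by (rule assms(1))
  note eq = demazure_product_eq_mult[OF assms(2-5)]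
    and len = affine_length_demazure_product[OF assms(2-5)]
  show ?thesis using eq len by auto
qed

end
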